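(* Let $p$ be an odd prime and let $G$ be a group of nilpotency class at most two and exponent $p$. Let $\mathrm{rank}(G^{\rm ab})=n$ with $n>1$, and let $\mathrm{rank}([G,G])=m$, where $n,m$ are finite. If $f\bigl(\binom{n}{2}-m+1\bigr)<n$, then $G$ is capable.
   Context: A group $G$ is capable if there exists a group $K$ such that $G\cong K/Z(K)$. Here $G^{\rm ab}=G/[G,G]$; for $G$ of class at most two and exponent $p$, both $G^{\rm ab}$ and $[G,G]$ are elementary abelian $p$-groups, and rank denotes the dimension as a vector space over $\mathbb{F}_p$. The function $f$ is defined on positive integers $k$ as follows: write $k=\binom{T}{2}+s$ with integers $T\ge 0$ and $0\le s\le T$; then $f(k)=\binom{T}{3}+\binom{s}{2}$ (this does not depend on the choice of such an expression for $k$). *)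

theory Defs
  imports
    "HOL-Algebra.Algebra"
    "HOL-Number_Theory.Residues"
    "Jordan_Normal_Form.Missing_VectorSpace"
begin

section \<open>Centre, abelianisation, nilpotency class, exponent\<close>

definition center :: "('a, 'b) monoid_scheme \<Rightarrow> 'a set" where
  "center G = {z \<in> carrier G. \<forall>x\<in>carrier G. z \<otimes>\<^bsub>G\<^esub> x = x \<otimes>\<^bsub>G\<^esub> z}"

definition commutator_group :: "('a, 'b) monoid_scheme \<Rightarrow> ('a, 'b) monoid_scheme" where
  "commutator_group G = G\<lparr>carrier := derived G (carrier G)\<rparr>"

definition abelianization :: "('a, 'b) monoid_scheme \<Rightarrow> 'a set monoid" where
  "abelianization G = G Mod derived G (carrier G)"

text \<open>Indexing starts at zero: \<^term>\<open>lower_central G 0\<close> is all of \<open>G\<close> and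
  \<^term>\<open>lower_central G 1\<close> is the commutator subgroup.\<close>

fun lower_central :: "('a, 'b) monoid_scheme \<Rightarrow> nat \<Rightarrow> 'a set" where
  "lower_central G 0 = carrier G"
| "lower_central G (Suc i) =
     generate G (\<Union>x\<in>lower_central G i. \<Union>y\<in>carrier G.
       {x \<otimes>\<^bsub>G\<^esub> y \<otimes>\<^bsub>G\<^esub> inv\<^bsub>G\<^esub> x \<otimes>\<^bsub>G\<^esub> inv\<^bsub>G\<^esub> y})"

definition nilpotency_class_le :: "('a, 'b) monoid_scheme \<Rightarrow> nat \<Rightarrow> bool" where
  "nilpotency_class_le G c \<longleftrightarrow> lower_central G c = {\<one>\<^bsub>G\<^esub>}"

definition has_exponent :: "('a, 'b) monoid_scheme \<Rightarrow> nat \<Rightarrow> bool" where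
  "has_exponent G e \<longleftrightarrow>
     e > 0 \<and> (\<forall>x\<in>carrier G. x [^]\<^bsub>G\<^esub> e = \<one>\<^bsub>G\<^esub>) \<and>
     (\<forall>d. 0 < d \<and> (\<forall>x\<in>carrier G. x [^]\<^bsub>G\<^esub> d = \<one>\<^bsub>G\<^esub>) \<longrightarrow> e \<le> d)"

section \<open>Rank of an elementary abelian group\<close>

text \<open>The group \<open>A\<close>, written additively, with an integer \<open>k\<close> acting as \<open>x \<mapsto> x\<^sup>k\<close>. When \<open>A\<close> is an
  elementary abelian \<open>p\<close>-group this is a vector space over \<^term>\<open>residue_ring (int p)\<close>, see
  \<open>vectorspace_power_module\<close> below. The fields \<open>mult\<close> and \<open>one\<close> of a module record play no role;
  they are there because module records extend ring records.\<close>

definition power_module :: "('a, 'b) monoid_scheme \<Rightarrow> (int, 'a) module" where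
  "power_module A =
     \<lparr>carrier = carrier A, monoid.mult = monoid.mult A, monoid.one = \<one>\<^bsub>A\<^esub>,
      ring.zero = \<one>\<^bsub>A\<^esub>, ring.add = monoid.mult A, module.smult = (\<lambda>k x. x [^]\<^bsub>A\<^esub> k)\<rparr>"

text \<open>\<^const>\<open>vectorspace.dim\<close> is meaningful only in finite dimension, so finiteness is stated
  explicitly.\<close>

definition has_rank :: "nat \<Rightarrow> ('a, 'b) monoid_scheme \<Rightarrow> nat \<Rightarrow> bool" where
  "has_rank p A r \<longleftrightarrow>
     vectorspace.fin_dim (residue_ring (int p)) (power_module A) \<and>
     vectorspace.dim (residue_ring (int p)) (power_module A) = r"

lemma vectorspace_power_module:
  assumes p: "Factorial_Ring.prime p" and A: "comm_group A"
    and ex: "\<And>x. x \<in> carrier A \<Longrightarrow> x [^]\<^bsub>A\<^esub> p = \<one>\<^bsub>A\<^esub>"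
  shows "vectorspace (residue_ring (int p)) (power_module A)"
proof -
  interpret A: comm_group A by (rule A)
  interpret R: residues_prime p "residue_ring (int p)"
    by unfold_locales (use p in auto)
  have ab: "abelian_group (power_module A)"
    by (rule abelian_groupI)
       (auto simp: power_module_def A.m_ac intro: A.l_inv_ex)
  have pk: "x [^]\<^bsub>A\<^esub> (int p * k) = \<one>\<^bsub>A\<^esub>" if "x \<in> carrier A" for x and k :: int
    using that ex by (simp add: A.int_pow_pow [symmetric] int_pow_int)
  have pm: "x [^]\<^bsub>A\<^esub> (k mod int p) = x [^]\<^bsub>A\<^esub> k" if x: "x \<in> carrier A" for x and k :: int
  proof -
    have "x [^]\<^bsub>A\<^esub> k = x [^]\<^bsub>A\<^esub> (int p * (k div int p) + k mod int p)" by simp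
    also have "\<dots> = x [^]\<^bsub>A\<^esub> (k mod int p)"
      unfolding A.int_pow_mult [OF x] pk [OF x] using x by simp
    finally show ?thesis by simp
  qed
  have "module (residue_ring (int p)) (power_module A)"
  proof (rule Module.moduleI [OF R.cring ab])
    fix a b x y
    assume "x \<in> carrier (power_module A)"
    then have x: "x \<in> carrier A" by (simp add: power_module_def)
    show "a \<odot>\<^bsub>power_module A\<^esub> x \<in> carrier (power_module A)"
      using x by (simp add: power_module_def)
    show "(a \<oplus>\<^bsub>residue_ring (int p)\<^esub> b) \<odot>\<^bsub>power_module A\<^esub> x =
        a \<odot>\<^bsub>power_module A\<^esub> x \<oplus>\<^bsub>power_module A\<^esub> b \<odot>\<^bsub>power_module A\<^esub> x"
      using x pm [OF x] by (simp add: power_module_def residue_ring_def A.int_pow_mult)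
    show "(a \<otimes>\<^bsub>residue_ring (int p)\<^esub> b) \<odot>\<^bsub>power_module A\<^esub> x =
        a \<odot>\<^bsub>power_module A\<^esub> (b \<odot>\<^bsub>power_module A\<^esub> x)"
      using x pm [OF x] A.int_pow_pow [OF x, of b a]
      by (simp add: power_module_def residue_ring_def mult.commute)
    show "\<one>\<^bsub>residue_ring (int p)\<^esub> \<odot>\<^bsub>power_module A\<^esub> x = x"
      using x by (simp add: power_module_def residue_ring_def)
    assume "y \<in> carrier (power_module A)"
    then have y: "y \<in> carrier A" by (simp add: power_module_def)
    show "a \<odot>\<^bsub>power_module A\<^esub> (x \<oplus>\<^bsub>power_module A\<^esub> y) =
        a \<odot>\<^bsub>power_module A\<^esub> x \<oplus>\<^bsub>power_module A\<^esub> a \<odot>\<^bsub>power_module A\<^esub> y"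
      using x y by (simp add: power_module_def A.int_pow_distrib)
  qed
  then show ?thesis
    unfolding vectorspace_def using R.is_field by simp
qed

section \<open>Capability\<close>

text \<open>A definition cannot quantify over the type of the elements of \<open>K\<close>, so \<open>K\<close> is taken on lists
  over the element type of \<open>G\<close>. This is no restriction: \<open>capableI\<close> shows that a witness on an
  arbitrary type can be replaced by one on lists. (The subgroup of \<open>K\<close> generated by one lift of each
  element of \<open>G\<close> has the same central quotient, and its elements are described by words.)\<close>

definition capable :: "('a, 'b) monoid_scheme \<Rightarrow> bool" where
  "capable G \<longleftrightarrow> (\<exists>K :: 'a list monoid. group K \<and> G \<cong> K Mod center K)"

lemma (in group) center_subgroup: "subgroup (center G) G"
proof
  show "center G \<subseteq> carrier G" by (auto simp: center_def)
  show "\<one> \<in> center G" by (auto simp: center_def)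
  fix x assume x: "x \<in> center G"
  { fix y assume y: "y \<in> center G"
    show "x \<otimes> y \<in> center G"
    proof -
      have xy: "x \<in> carrier G" "y \<in> carrier G" using x y by (auto simp: center_def)
      have "x \<otimes> y \<otimes> z = z \<otimes> (x \<otimes> y)" if z: "z \<in> carrier G" for z
      proof -
        have "x \<otimes> y \<otimes> z = x \<otimes> (y \<otimes> z)" using xy z by (simp add: m_assoc)
        also have "y \<otimes> z = z \<otimes> y" using y z by (simp add: center_def)
        also have "x \<otimes> (z \<otimes> y) = x \<otimes> z \<otimes> y" using xy z by (simp add: m_assoc)
        also have "x \<otimes> z = z \<otimes> x" using x z by (simp add: center_def)
        finally show ?thesis using xy z by (simp add: m_assoc)
      qed
      then show ?thesis using xy by (simp add: center_def)
    qed }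
  have xc: "x \<in> carrier G" using x by (auto simp: center_def)
  have "inv x \<otimes> z = z \<otimes> inv x" if z: "z \<in> carrier G" for z
  proof -
    have "z = inv x \<otimes> (x \<otimes> z)" using xc z by (simp add: m_assoc [symmetric])
    also have "\<dots> = inv x \<otimes> (z \<otimes> x)" using x z by (auto simp: center_def)
    finally have "z \<otimes> inv x = inv x \<otimes> z \<otimes> x \<otimes> inv x" using xc z by (simp add: m_assoc)
    then show ?thesis using xc z by (simp add: m_assoc)
  qed
  then show "inv x \<in> center G" using xc by (auto simp: center_def)
qed

lemma (in group) center_normal: "center G \<lhd> G"
proof (rule normal_invI [OF center_subgroup])
  fix x h assume x: "x \<in> carrier G" and h: "h \<in> center G"
  then have "x \<otimes> h \<otimes> inv x = h \<otimes> x \<otimes> inv x" by (auto simp: center_def)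
  also have "\<dots> = h \<otimes> (x \<otimes> inv x)"
    using x h by (intro m_assoc) (auto simp: center_def)
  also have "\<dots> = h" using x h by (simp add: center_def)
  finally show "x \<otimes> h \<otimes> inv x \<in> center G" using h by simp
qed

lemma ex_inj_signed_words: "\<exists>c :: ('a \<times> bool) list \<Rightarrow> 'a list. inj c"
proof (cases "\<exists>a b :: 'a. a \<noteq> b")
  case True
  then obtain a b :: 'a where ab: "a \<noteq> b" by blast
  define c :: "('a \<times> bool) list \<Rightarrow> 'a list"
    where "c w = concat (map (\<lambda>p. [fst p, if snd p then a else b]) w)" for w
  have c_Cons: "c (p # w) = fst p # (if snd p then a else b) # c w" for p w
    by (simp add: c_def)
  have c_Nil: "c [] = []" by (simp add: c_def)
  have "c v = c w \<longrightarrow> v = w" for v w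
  proof (induction v arbitrary: w)
    case Nil show ?case by (cases w) (simp_all add: c_Nil c_Cons)
  next
    case (Cons p v)
    show ?case
    proof (cases w)
      case Nil then show ?thesis by (simp add: c_Nil c_Cons)
    next
      case w: (Cons q w')
      show ?thesis
      proof
        assume "c (p # v) = c w"
        then have "fst p = fst q" "(if snd p then a else b) = (if snd q then a else b)" "c v = c w'"
          by (simp_all add: w c_Cons)
        moreover from this ab have "snd p = snd q" by (simp split: if_splits)
        ultimately show "p # v = w" using Cons.IH [of w'] by (simp add: w prod_eq_iff)
      qed
    qed
  qed
  then have "inj c" by (simp add: inj_def)
  then show ?thesis by (intro exI [of _ c])
next
  case False
  then have eq: "a = b" for a b :: 'a by blast
  define c :: "('a \<times> bool) list \<Rightarrow> 'a list"
    where "c w = replicate (to_nat (map snd w)) undefined" for w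
  have len: "length (c w) = to_nat (map snd w)" for w by (simp add: c_def)
  have "inj c"
  proof (rule injI)
    fix v w assume "c v = c w"
    then have "to_nat (map snd v) = to_nat (map snd w)" by (metis len)
    then have snd: "map snd v = map snd w" by (rule injD [OF inj_to_nat])
    then have "length v = length w" by (rule map_eq_imp_length_eq)
    then have "map fst v = map fst w"
      by (intro nth_equalityI) (simp, rule eq)
    with snd show "v = w" by (metis zip_map_fst_snd)
  qed
  then show ?thesis by (intro exI [of _ c])
qed

lemma (in group) generate_inj_words:
  fixes s :: "'x \<Rightarrow> 'a"
  assumes s: "s ` S \<subseteq> carrier G"
  shows "\<exists>e :: 'a \<Rightarrow> 'x list. inj_on e (generate G (s ` S))"
proof -
  define ev :: "('x \<times> bool) list \<Rightarrow> 'a"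
    where "ev w = foldr (\<lambda>(x, b) y. (if b then s x else inv (s x)) \<otimes> y) w \<one>" for w
  define W where "W = lists (S \<times> (UNIV :: bool set))"
  have ev_closed: "ev w \<in> carrier G" if "w \<in> W" for w
    using that unfolding W_def by (induction w) (use s in \<open>auto simp: ev_def\<close>)
  have ev_append: "ev (v @ w) = ev v \<otimes> ev w" if "v \<in> W" "w \<in> W" for v w
    using that(1) unfolding W_def
  proof (induction v)
    case Nil then show ?case using ev_closed [OF that(2)] by (simp add: ev_def)
  next
    case (Cons x v)
    then have "ev v \<in> carrier G" using ev_closed by (simp add: W_def)
    then show ?case
      using Cons s ev_closed [OF that(2)] by (auto simp: ev_def m_assoc)
  qed
  have sub: "generate G (s ` S) \<subseteq> ev ` W"
  proof
    fix g assume "g \<in> generate G (s ` S)"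
    then show "g \<in> ev ` W"
    proof induction
      case one show ?case by (rule image_eqI [of _ _ "[]"]) (auto simp: ev_def W_def)
    next
      case (incl h)
      then obtain x where "x \<in> S" "h = s x" by auto
      then show ?case using s
        by (intro image_eqI [of _ _ "[(x, True)]"]) (auto simp: ev_def W_def)
    next
      case (inv h)
      then obtain x where "x \<in> S" "h = s x" by auto
      then show ?case using s
        by (intro image_eqI [of _ _ "[(x, False)]"]) (auto simp: ev_def W_def)
    next
      case (eng h1 h2)
      then obtain v w where "v \<in> W" "w \<in> W" "h1 = ev v" "h2 = ev w" by auto
      then show ?case
        by (intro image_eqI [of _ _ "v @ w"]) (auto simp: ev_append, auto simp: W_def)
    qed
  qed
  obtain c :: "('x \<times> bool) list \<Rightarrow> 'x list" where c: "inj c"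
    using ex_inj_signed_words by (rule exE)
  have "inj_on (c \<circ> inv_into W ev) (generate G (s ` S))"
    by (intro comp_inj_on inj_on_inv_into sub inj_on_subset [OF c] subset_UNIV)
  then show ?thesis by (intro exI [of _ "c \<circ> inv_into W ev"])
qed

theorem capableI:
  fixes G :: "('a, 'b) monoid_scheme" and L :: "('c, 'd) monoid_scheme"
  assumes G: "group G" and L: "group L" and iso: "G \<cong> L Mod center L"
  shows "capable G"
proof -
  interpret L: group L by (rule L)
  interpret Z: normal "center L" L by (rule L.center_normal)
  let ?Q = "L Mod center L"
  have Q: "group ?Q" by (rule Z.factorgroup_is_group)
  obtain h where h: "h \<in> iso G ?Q" using iso by (auto simp: is_iso_def)
  have hb: "bij_betw h (carrier G) (carrier ?Q)" using h by (auto simp: iso_def)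
  have "\<exists>x\<in>carrier L. h g = center L #>\<^bsub>L\<^esub> x" if "g \<in> carrier G" for g
  proof -
    have "h g \<in> carrier ?Q" using bij_betw_apply [OF hb that] .
    then show ?thesis unfolding carrier_FactGroup by blast
  qed
  then have "\<forall>g\<in>carrier G. \<exists>x. x \<in> carrier L \<and> h g = center L #>\<^bsub>L\<^esub> x" by blast
  from bchoice [OF this] obtain s
    where s': "\<forall>g\<in>carrier G. s g \<in> carrier L \<and> h g = center L #>\<^bsub>L\<^esub> s g" by blast
  have s: "s g \<in> carrier L" and hs: "h g = center L #>\<^bsub>L\<^esub> s g" if "g \<in> carrier G" for g
    using s' that by simp_all
  have sS: "s ` carrier G \<subseteq> carrier L" using s by auto
  define H where "H = generate L (s ` carrier G)"
  have H: "subgroup H L" unfolding H_def by (rule L.generate_is_subgroup [OF sS])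
  have HL: "x \<in> carrier L" if "x \<in> H" for x using subgroup.subset [OF H] that by auto
  have sH: "s g \<in> H" if "g \<in> carrier G" for g
    unfolding H_def using that by (auto intro: generate.incl)
  have cover: "\<exists>z\<in>center L. \<exists>g\<in>carrier G. l = z \<otimes>\<^bsub>L\<^esub> s g" if l: "l \<in> carrier L" for l
  proof -
    have "center L #>\<^bsub>L\<^esub> l \<in> carrier ?Q" using l by (auto simp: carrier_FactGroup)
    then obtain g where g: "g \<in> carrier G" "center L #>\<^bsub>L\<^esub> l = h g"
      unfolding bij_betw_imp_surj_on [OF hb, symmetric] by blast
    then have "l \<in> center L #>\<^bsub>L\<^esub> s g"
      using L.rcos_self [OF l L.center_subgroup] hs by metis
    then show ?thesis using g by (auto simp: r_coset_def)
  qed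
  have cent: "x \<in> center L" if x: "x \<in> H" and xc: "\<And>y. y \<in> H \<Longrightarrow> x \<otimes>\<^bsub>L\<^esub> y = y \<otimes>\<^bsub>L\<^esub> x" for x
  proof -
    have xL: "x \<in> carrier L" by (rule HL [OF x])
    have "x \<otimes>\<^bsub>L\<^esub> l = l \<otimes>\<^bsub>L\<^esub> x" if lL: "l \<in> carrier L" for l
    proof -
      obtain z g where z: "z \<in> center L" and g: "g \<in> carrier G" and l: "l = z \<otimes>\<^bsub>L\<^esub> s g"
        using cover [OF lL] by blast
      have zL: "z \<in> carrier L" and zx: "z \<otimes>\<^bsub>L\<^esub> x = x \<otimes>\<^bsub>L\<^esub> z"
        using z xL unfolding center_def by blast+
      note sL = s [OF g]
      have "x \<otimes>\<^bsub>L\<^esub> (z \<otimes>\<^bsub>L\<^esub> s g) = x \<otimes>\<^bsub>L\<^esub> z \<otimes>\<^bsub>L\<^esub> s g"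
        by (rule L.m_assoc [OF xL zL sL, symmetric])
      also have "\<dots> = z \<otimes>\<^bsub>L\<^esub> x \<otimes>\<^bsub>L\<^esub> s g" by (simp only: zx)
      also have "\<dots> = z \<otimes>\<^bsub>L\<^esub> (x \<otimes>\<^bsub>L\<^esub> s g)" by (rule L.m_assoc [OF zL xL sL])
      also have "\<dots> = z \<otimes>\<^bsub>L\<^esub> (s g \<otimes>\<^bsub>L\<^esub> x)" by (simp only: xc [OF sH [OF g]])
      also have "\<dots> = z \<otimes>\<^bsub>L\<^esub> s g \<otimes>\<^bsub>L\<^esub> x" by (rule L.m_assoc [OF zL sL xL, symmetric])
      finally show ?thesis unfolding l .
    qed
    then show ?thesis using HL [OF x] unfolding center_def by blast
  qed
  obtain e :: "'c \<Rightarrow> 'a list" where e: "inj_on e H"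
    using L.generate_inj_words [OF sS] unfolding H_def by (rule exE)
  define d where "d = inv_into H e"
  have de [simp]: "d (e x) = x" if "x \<in> H" for x using that e by (simp add: d_def)
  define K :: "'a list monoid" where
    "K = \<lparr>carrier = e ` H, monoid.mult = (\<lambda>u v. e (d u \<otimes>\<^bsub>L\<^esub> d v)), one = e \<one>\<^bsub>L\<^esub>\<rparr>"
  have mH: "x \<otimes>\<^bsub>L\<^esub> y \<in> H" if "x \<in> H" "y \<in> H" for x y using H that by (rule subgroup.m_closed)
  have oH: "\<one>\<^bsub>L\<^esub> \<in> H" using H by (rule subgroup.one_closed)
  have iH: "inv\<^bsub>L\<^esub> x \<in> H" if "x \<in> H" for x using H that by (rule subgroup.m_inv_closed)
  have K: "group K"
  proof (rule groupI)
    fix u assume "u \<in> carrier K"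
    then obtain x where x: "x \<in> H" "u = e x" by (auto simp: K_def)
    have "e (inv\<^bsub>L\<^esub> x) \<in> carrier K" using x iH by (auto simp: K_def)
    moreover have "e (inv\<^bsub>L\<^esub> x) \<otimes>\<^bsub>K\<^esub> u = \<one>\<^bsub>K\<^esub>" using x iH HL by (simp add: K_def)
    ultimately show "\<exists>v\<in>carrier K. v \<otimes>\<^bsub>K\<^esub> u = \<one>\<^bsub>K\<^esub>" by blast
  next
    fix u v w assume "u \<in> carrier K" "v \<in> carrier K" "w \<in> carrier K"
    then obtain x y z where "x \<in> H" "y \<in> H" "z \<in> H" "u = e x" "v = e y" "w = e z"
      by (auto simp: K_def)
    then show "u \<otimes>\<^bsub>K\<^esub> v \<otimes>\<^bsub>K\<^esub> w = u \<otimes>\<^bsub>K\<^esub> (v \<otimes>\<^bsub>K\<^esub> w)"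
      by (simp add: K_def mH HL L.m_assoc)
  next
    fix u v assume "u \<in> carrier K" "v \<in> carrier K"
    then show "u \<otimes>\<^bsub>K\<^esub> v \<in> carrier K" by (auto simp: K_def mH)
  next
    show "\<one>\<^bsub>K\<^esub> \<in> carrier K" by (simp add: K_def oH)
    fix u assume "u \<in> carrier K"
    then show "\<one>\<^bsub>K\<^esub> \<otimes>\<^bsub>K\<^esub> u = u" by (auto simp: K_def oH HL)
  qed
  define \<psi> where "\<psi> u = center L #>\<^bsub>L\<^esub> d u" for u
  have \<psi>: "\<psi> \<in> hom K ?Q"
  proof (rule homI)
    fix u assume "u \<in> carrier K"
    then show "\<psi> u \<in> carrier ?Q" by (auto simp: \<psi>_def K_def carrier_FactGroup HL)
    fix v assume "v \<in> carrier K"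
    with \<open>u \<in> carrier K\<close> obtain x y where "x \<in> H" "y \<in> H" "u = e x" "v = e y"
      by (auto simp: K_def)
    then show "\<psi> (u \<otimes>\<^bsub>K\<^esub> v) = \<psi> u \<otimes>\<^bsub>?Q\<^esub> \<psi> v"
      by (simp add: \<psi>_def K_def mH HL Z.rcos_sum)
  qed
  interpret \<psi>: group_hom K ?Q \<psi>
    using K Q \<psi> by (simp add: group_hom_def group_hom_axioms_def)
  have surj: "\<psi> ` carrier K = carrier ?Q"
  proof
    show "\<psi> ` carrier K \<subseteq> carrier ?Q" using \<psi> by (auto simp: hom_def)
    show "carrier ?Q \<subseteq> \<psi> ` carrier K"
    proof
      fix q assume "q \<in> carrier ?Q"
      then obtain g where g: "g \<in> carrier G" "q = h g"
        unfolding bij_betw_imp_surj_on [OF hb, symmetric] by blast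
      then show "q \<in> \<psi> ` carrier K"
        using hs sH by (intro image_eqI [of _ _ "e (s g)"]) (auto simp: \<psi>_def K_def)
    qed
  qed
  have coset: "center L #>\<^bsub>L\<^esub> x = center L \<longleftrightarrow> x \<in> center L" if "x \<in> carrier L" for x
  proof
    assume "center L #>\<^bsub>L\<^esub> x = center L"
    then show "x \<in> center L" using L.rcos_self [OF that L.center_subgroup] by simp
  next
    assume "x \<in> center L"
    then show "center L #>\<^bsub>L\<^esub> x = center L"
      by (rule L.coset_join2 [OF that L.center_subgroup])
  qed
  have cK: "e x \<in> center K \<longleftrightarrow> x \<in> center L" if x: "x \<in> H" for x
  proof
    assume xK: "e x \<in> center K"
    show "x \<in> center L"
    proof (rule cent [OF x])
      fix y assume y: "y \<in> H"
      have "e y \<in> carrier K" using y by (simp add: K_def)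
      then have "e x \<otimes>\<^bsub>K\<^esub> e y = e y \<otimes>\<^bsub>K\<^esub> e x" using xK unfolding center_def by blast
      then have "e (x \<otimes>\<^bsub>L\<^esub> y) = e (y \<otimes>\<^bsub>L\<^esub> x)" by (simp add: K_def x y)
      then show "x \<otimes>\<^bsub>L\<^esub> y = y \<otimes>\<^bsub>L\<^esub> x" by (rule inj_onD [OF e _ mH [OF x y] mH [OF y x]])
    qed
  next
    assume xL: "x \<in> center L"
    have "e x \<otimes>\<^bsub>K\<^esub> v = v \<otimes>\<^bsub>K\<^esub> e x" if vK: "v \<in> carrier K" for v
    proof -
      obtain y where y: "y \<in> H" and v: "v = e y" using vK by (auto simp: K_def)
      have "x \<otimes>\<^bsub>L\<^esub> y = y \<otimes>\<^bsub>L\<^esub> x" using xL HL [OF y] unfolding center_def by blast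
      then have "e (x \<otimes>\<^bsub>L\<^esub> y) = e (y \<otimes>\<^bsub>L\<^esub> x)" by (rule arg_cong)
      then show ?thesis unfolding v by (simp add: K_def x y)
    qed
    moreover have "e x \<in> carrier K" using x by (simp add: K_def)
    ultimately show "e x \<in> center K" unfolding center_def by blast
  qed
  have ker: "kernel K ?Q \<psi> = center K"
  proof (rule Set.set_eqI)
    fix u
    have "center K \<subseteq> carrier K" unfolding center_def by blast
    then have "u \<in> center K \<longleftrightarrow> u \<in> carrier K \<and> u \<in> center K" by blast
    also have "\<dots> \<longleftrightarrow> u \<in> carrier K \<and> center L #>\<^bsub>L\<^esub> d u = center L"
    proof (rule conj_cong [OF refl])
      assume "u \<in> carrier K"
      then obtain x where x: "x \<in> H" and u: "u = e x" by (auto simp: K_def)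
      show "u \<in> center K \<longleftrightarrow> center L #>\<^bsub>L\<^esub> d u = center L"
        unfolding u de [OF x] coset [OF HL [OF x]] by (rule cK [OF x])
    qed
    finally show "u \<in> kernel K ?Q \<psi> \<longleftrightarrow> u \<in> center K"
      by (simp add: kernel_def \<psi>_def)
  qed
  have "K Mod center K \<cong> ?Q" using \<psi>.FactGroup_iso [OF surj] ker by simp
  then have "?Q \<cong> K Mod center K"
    by (rule group.iso_sym [rotated])
       (rule normal.factorgroup_is_group [OF group.center_normal [OF K]])
  then have "G \<cong> K Mod center K" using iso by (rule iso_trans [rotated])
  then show ?thesis using K by (auto simp: capable_def)
qed

section \<open>The numerical function\<close>

definition cap_f :: "nat \<Rightarrow> nat" where
  "cap_f k = (THE v. \<exists>T s. k = (T choose 2) + s \<and> s \<le> T \<and> v = (T choose 3) + (s choose 2))"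

lemma cap_f_eq:
  assumes "s \<le> T"
  shows "cap_f ((T choose 2) + s) = (T choose 3) + (s choose 2)"
proof -
  have step: "Suc t choose 2 = (t choose 2) + t" "Suc t choose 3 = (t choose 3) + (t choose 2)" for t
    by (simp_all add: numeral_2_eq_2 numeral_3_eq_3)
  have le: "(T choose 3) + (s choose 2) = (U choose 3) + (t choose 2)"
    if s: "s \<le> T" and TU: "T \<le> U" and eq: "(T choose 2) + s = (U choose 2) + t" for T s U t
  proof (cases "T = U")
    case True then show ?thesis using eq by simp
  next
    case False
    then have "Suc T choose 2 \<le> U choose 2" using TU by (intro binomial_right_mono) simp
    then have t: "t = 0" and sT: "s = T" and U2: "U choose 2 = Suc T choose 2"
      using eq s step(1) [of T] by linarith+
    have "U = Suc T"
    proof (rule ccontr)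
      assume "U \<noteq> Suc T"
      then have "Suc (Suc T) choose 2 \<le> U choose 2"
        using False TU by (intro binomial_right_mono) simp
      then show False using U2 step(1) [of "Suc T"] by linarith
    qed
    then show ?thesis by (simp add: t sT step(2) [of T])
  qed
  show ?thesis
    unfolding cap_f_def
  proof (rule the_equality)
    show "\<exists>U t. (T choose 2) + s = (U choose 2) + t \<and> t \<le> U \<and>
        (T choose 3) + (s choose 2) = (U choose 3) + (t choose 2)"
      using assms by (intro exI [of _ T] exI [of _ s]) simp
  next
    fix v
    assume "\<exists>U t. (T choose 2) + s = (U choose 2) + t \<and> t \<le> U \<and> v = (U choose 3) + (t choose 2)"
    then obtain U t where U: "(T choose 2) + s = (U choose 2) + t" "t \<le> U"
      and v: "v = (U choose 3) + (t choose 2)" by (elim exE conjE)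
    show "v = (T choose 3) + (s choose 2)"
      using le [OF assms _ U(1)] le [OF U(2) _ U(1) [symmetric]] v linear [of T U] by metis
  qed
qed

lemma cap_f_ex: "\<exists>T s. k = (T choose 2) + s \<and> s \<le> T"
proof (induction k)
  case 0 show ?case by (intro exI [of _ 0]) simp
next
  case (Suc k)
  then obtain T s where k: "k = (T choose 2) + s" and s: "s \<le> T" by (elim exE conjE)
  show ?case
  proof (cases "s = T")
    case True
    have "Suc k = (Suc T choose 2) + 1" by (simp add: k True numeral_2_eq_2)
    then show ?thesis by (intro exI [of _ "Suc T"] exI [of _ 1]) simp
  next
    case False
    then show ?thesis using k s by (intro exI [of _ T] exI [of _ "Suc s"]) simp
  qed
qed

end

theory Submission
  imports Defs "HOL-Library.Nat_Bijection"
begin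

text \<open>
  Choose \<open>x\<^sub>1, \<dots>, x\<^sub>n\<close> lifting a basis of the abelianization \<open>V\<close>, and let \<open>R \<subseteq> \<Lambda>\<^sup>2V\<close> be the space of
  relations between their commutators; its dimension is \<open>k = (n choose 2) - m\<close>.  A group \<open>K\<close> of units
  of the tensor algebra on \<open>V\<close>, truncated above degree three, maps onto \<open>G\<close> with kernel given in degree
  two by \<open>R\<close>.  Dividing \<open>K\<close> by the degree three part \<open>[R, V]\<close>, the quotient by the centre is \<open>G\<close> as
  soon as \<open>R\<close> is closed: \<open>[\<alpha>, V] \<subseteq> [R, V]\<close> implies \<open>\<alpha> \<in> R\<close>.

  If \<open>\<alpha> \<notin> R\<close> and \<open>[\<alpha>, e\<^sub>i] = \<Sum>j. [\<xi>\<^sub>i\<^sub>j, e\<^sub>j]\<close> with \<open>\<xi>\<^sub>i\<^sub>j \<in> R\<close> for every \<open>i\<close>, then the \<open>n\<close> families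
  \<open>(\<delta>\<^sub>i\<^sub>j \<alpha> - \<xi>\<^sub>i\<^sub>j)\<^sub>j\<close> are the slices of \<open>n\<close> independent elements of \<open>\<Lambda>\<^sup>3V\<close>, all lying in \<open>R + \<langle>\<alpha>\<rangle>\<close>.
  For a suitable monomial order their leading monomials are triangles in the graph formed by the \<open>k + 1\<close>
  leading monomials of \<open>R + \<langle>\<alpha>\<rangle>\<close>, and by Kruskal-Katona such a graph has at most \<open>f (k + 1) < n\<close>
  triangles.
\<close>

section \<open>Triangles in a graph\<close>

text \<open>Incrementing \<open>k\<close> either raises \<open>s\<close> by one or, when
  \<open>s = T\<close>, passes to the pair \<open>(Suc T, 1)\<close>. Monotonicity finally lets the
  number of leading pairs be replaced by its upper bound.\<close>

lemma cap_f_mono: "mono cap_f"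
proof (rule mono_iff_le_Suc [THEN iffD2], rule allI)
  fix k
  obtain T s where k: "k = (T choose 2) + s" and s: "s \<le> T"
    using cap_f_ex by blast
  show "cap_f k \<le> cap_f (Suc k)"
  proof (cases "s = T")
    case True
    have "Suc k = (Suc T choose 2) + 1" by (simp add: k True numeral_2_eq_2)
    then have "cap_f (Suc k) = (Suc T choose 3) + (1 choose 2)"
      using cap_f_eq [of 1 "Suc T"] by simp
    moreover have "cap_f k = (T choose 3) + (T choose 2)"
      using cap_f_eq [OF s] by (simp add: k True)
    ultimately show ?thesis by (simp add: numeral_2_eq_2 numeral_3_eq_3)
  next
    case False
    then have "cap_f (Suc k) = (T choose 3) + (Suc s choose 2)"
      using cap_f_eq [of "Suc s" T] s by (simp add: k)
    moreover have "cap_f k = (T choose 3) + (s choose 2)"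
      using cap_f_eq [OF s] by (simp add: k)
    ultimately show ?thesis by (simp add: numeral_2_eq_2)
  qed
qed

text \<open>Convexity: with \<open>a = c + u\<close>, \<open>b = c + v\<close> and
  \<open>d = c + u + v\<close>, the right side exceeds the left by exactly
  \<open>u * v\<close>.\<close>

lemma choose_two_convex:
  fixes a b c d :: nat
  assumes "a + b = c + d" "c \<le> a" "c \<le> b"
  shows "(a choose 2) + (b choose 2) \<le> (c choose 2) + (d choose 2)"
proof -
  define u v where "u = a - c" and "v = b - c"
  then have u: "a = c + u" "b = c + v" "d = c + u + v" using assms by auto
  have tri: "2 * (n choose 2) + n = n * n" for n :: nat
    by (induction n) (auto simp: numeral_2_eq_2)
  have "2 * ((a choose 2) + (b choose 2)) + (a + b) \<le> 2 * ((c choose 2) + (d choose 2)) + (c + d)"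
    using tri [of a] tri [of b] tri [of c] tri [of d] unfolding u by (simp add: algebra_simps)
  then have "2 * ((a choose 2) + (b choose 2)) \<le> 2 * ((c choose 2) + (d choose 2))"
    unfolding assms(1) by (simp only: add_le_cancel_right)
  then show ?thesis by (simp only: nat_mult_le_cancel_disj)
qed

text \<open>Arithmetic of deleting \<open>d\<close> edges at one vertex: they come off the remainder
  \<open>s\<close> if \<open>d \<le> s\<close>, otherwise one borrows from \<open>T\<close>; in both
  cases convexity compares the outcome.\<close>

lemma cap_f_diff:
  assumes "Suc d choose 2 \<le> k"
  shows "cap_f (k - d) + (d choose 2) \<le> cap_f k"
proof -
  obtain T s where k: "k = (T choose 2) + s" and s: "s \<le> T"
    using cap_f_ex by blast
  have step: "Suc t choose 2 = (t choose 2) + t" "Suc t choose 3 = (t choose 3) + (t choose 2)" for t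
    by (simp_all add: numeral_2_eq_2 numeral_3_eq_3)
  have fk: "cap_f k = (T choose 3) + (s choose 2)" using cap_f_eq [OF s] k by simp
  show ?thesis
  proof (cases "d \<le> s")
    case True
    have "k - d = (T choose 2) + (s - d)" using True k by simp
    then have "cap_f (k - d) = (T choose 3) + (s - d choose 2)"
      using cap_f_eq [of "s - d" T] s by simp
    moreover have "(s - d choose 2) + (d choose 2) \<le> (0 choose 2) + (s choose 2)"
      using True by (intro choose_two_convex) auto
    ultimately show ?thesis using fk by (simp add: numeral_2_eq_2)
  next
    case False
    \<comment> \<open>For \<open>d \<ge> T\<close> the number \<open>Suc d choose 2\<close> would be
      at least \<open>(T choose 2) + T\<close>, which leaves only \<open>s = T\<close> and
      \<open>d = T\<close>, against \<open>d > s\<close>.\<close>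
    have "d < T"
    proof (rule ccontr)
      assume "\<not> d < T"
      then have "Suc T choose 2 \<le> Suc d choose 2" by (intro binomial_right_mono) simp
      then have "s = T" using assms k s step(1) [of T] by linarith
      then show False
      proof (cases "d = T")
        case False
        then have "Suc (Suc T) choose 2 \<le> Suc d choose 2"
          using \<open>\<not> d < T\<close> by (intro binomial_right_mono) simp
        then show ?thesis using assms k s step(1) [of T] step(1) [of "Suc T"] by linarith
      qed (use \<open>\<not> d \<le> s\<close> in simp)
    qed
    then obtain U where T: "T = Suc U" and dU: "d \<le> U" by (cases T) auto
    \<comment> \<open>\<open>T choose 2\<close> is \<open>(U choose 2) + U\<close>; the new
      remainder is at most \<open>U\<close> because \<open>s < d\<close>.\<close>
    have "k - d = (U choose 2) + (U + s - d)" using dU by (simp add: k T step)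
    then have "cap_f (k - d) = (U choose 3) + (U + s - d choose 2)"
      using cap_f_eq [of "U + s - d" U] False by simp
    moreover have "(U + s - d choose 2) + (d choose 2) \<le> (s choose 2) + (U choose 2)"
      using False dU by (intro choose_two_convex) auto
    ultimately show ?thesis using fk by (simp add: T step)
  qed
qed

text \<open>Deleting a vertex of minimal degree \<open>d\<close> destroys at most \<open>d choose 2\<close> triangles, and
  \<open>Suc d choose 2\<close> is at most the number of edges.\<close>

lemma card_triangles_le_cap_f:
  assumes "finite E" and "\<And>e. e \<in> E \<Longrightarrow> card e = 2"
    and "\<And>t. t \<in> T \<Longrightarrow> card t = 3" and "\<And>t e. t \<in> T \<Longrightarrow> e \<subseteq> t \<Longrightarrow> card e = 2 \<Longrightarrow> e \<in> E"
  shows "card T \<le> cap_f (card E)"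
  using assms
proof (induction "card E" arbitrary: E T rule: less_induct)
  case less
  note E2 = less.prems(2) and T3 = less.prems(3) and TE = less.prems(4)
  have fe: "finite e" if "e \<in> E" for e using E2 [OF that] by (metis card.infinite zero_neq_numeral)
  define deg where "deg v = card {e \<in> E. v \<in> e}" for v
  have sub: "\<exists>e \<in> E. v \<in> e" if t: "t \<in> T" and v: "v \<in> t" for t v
  proof -
    have ft: "finite t" using T3 [OF t] by (metis card.infinite zero_neq_numeral)
    have "card (t - {v}) = 2" using T3 [OF t] v ft by simp
    then obtain a b where ab: "t - {v} = {a, b}" "a \<noteq> b" by (auto simp: card_2_iff)
    then have "{v, a} \<subseteq> t" "card {v, a} = 2" using v by (auto simp: card_2_iff)
    then show ?thesis using TE [OF t] by blast
  qed
  show ?case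
  proof (cases "E = {}")
    case True
    have "t = {}" if "t \<in> T" for t using sub [OF that] True by blast
    then have "T = {}" using T3 by fastforce
    then show ?thesis by simp
  next
    case False
    define V where "V = \<Union>E"
    have fV: "finite V" unfolding V_def using less.prems(1) fe by blast
    have Vne: "V \<noteq> {}" unfolding V_def using False E2 by fastforce
    obtain v where v: "v \<in> V" and vmin: "\<And>u. u \<in> V \<Longrightarrow> deg v \<le> deg u"
      using ex_is_arg_min_if_finite [OF fV Vne, of deg] by (auto simp: is_arg_min_linorder)
    define d where "d = deg v"
    define N where "N = {u. u \<noteq> v \<and> {v, u} \<in> E}"
    have bij: "bij_betw (\<lambda>u. {v, u}) N {e \<in> E. v \<in> e}"
    proof (rule bij_betwI')
      fix x y assume "x \<in> N" "y \<in> N"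
      then show "({v, x} = {v, y}) = (x = y)" by (auto simp: N_def doubleton_eq_iff)
    next
      fix x assume "x \<in> N" then show "{v, x} \<in> {e \<in> E. v \<in> e}" by (auto simp: N_def)
    next
      fix e assume e: "e \<in> {e \<in> E. v \<in> e}"
      then have "card e = 2" using E2 by blast
      then obtain a b where "e = {a, b}" "a \<noteq> b" by (auto simp: card_2_iff)
      then show "\<exists>x\<in>N. e = {v, x}" using e by (auto simp: N_def insert_commute)
    qed
    then have cN: "card N = d" by (simp add: d_def deg_def bij_betw_same_card)
    have NV: "insert v N \<subseteq> V" using v by (auto simp: N_def V_def)
    have fN: "finite N" using NV fV by (meson finite_subset finite_insert)
    have "Suc d \<le> card V"
      using card_mono [OF fV NV] fN cN by (simp add: N_def)
    \<comment> \<open>Incidences are counted twice. Every degree is at least \<open>d\<close>, and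
      \<open>V\<close> contains \<open>v\<close> with its \<open>d\<close> neighbours, so
      \<open>Suc d * d\<close> is at most twice the number of edges.\<close>
    have "(\<Sum>u\<in>V. deg u) = 2 * card E"
      unfolding deg_def
    proof (rule sum_multicount [OF fV less.prems(1)])
      show "\<forall>e\<in>E. card {u \<in> V. u \<in> e} = 2"
      proof
        fix e assume e: "e \<in> E"
        then have "{u \<in> V. u \<in> e} = e" by (auto simp: V_def)
        then show "card {u \<in> V. u \<in> e} = 2" using E2 [OF e] by simp
      qed
    qed
    moreover have "card V * d \<le> (\<Sum>u\<in>V. deg u)"
      using sum_bounded_below [of V d deg] vmin by (simp add: d_def)
    ultimately have "Suc d * d \<le> 2 * card E"
      using \<open>Suc d \<le> card V\<close> by (metis le_trans mult_le_mono1)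
    then have dE: "Suc d choose 2 \<le> card E" by (simp add: choose_two)
    define E' where "E' = {e \<in> E. v \<notin> e}"
    define T' where "T' = {t \<in> T. v \<notin> t}"
    have "E = E' \<union> {e \<in> E. v \<in> e}" "E' \<inter> {e \<in> E. v \<in> e} = {}" by (auto simp: E'_def)
    then have cE': "card E = card E' + d"
      using less.prems(1) card_Un_disjoint [of E' "{e \<in> E. v \<in> e}"]
      unfolding d_def deg_def by (metis finite_Un)
    have dpos: "0 < d"
    proof -
      obtain e where "e \<in> E" "v \<in> e" using v by (auto simp: V_def)
      then show ?thesis unfolding d_def deg_def using less.prems(1) by (auto simp: card_gt_0_iff)
    qed
    have "card T' \<le> cap_f (card E')"
    proof (rule less.hyps)
      show "card E' < card E" using cE' dpos by simp
      show "finite E'" using less.prems(1) by (simp add: E'_def)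
      fix t e assume "t \<in> T'" "e \<subseteq> t" "card e = 2"
      then show "e \<in> E'" using TE by (auto simp: E'_def T'_def)
    qed (auto simp: E'_def T'_def E2 T3)
    moreover have "card {t \<in> T. v \<in> t} \<le> d choose 2"
    proof -
      \<comment> \<open>A triangle through \<open>v\<close> is recovered from its opposite edge,
        whose ends are neighbours of \<open>v\<close>.\<close>
      have "card {t \<in> T. v \<in> t} \<le> card {B. B \<subseteq> N \<and> card B = 2}"
      proof (rule card_inj_on_le [where f = "\<lambda>t. t - {v}"])
        show "inj_on (\<lambda>t. t - {v}) {t \<in> T. v \<in> t}"
          by (rule inj_onI) (metis (no_types, lifting) insert_Diff mem_Collect_eq)
        show "(\<lambda>t. t - {v}) ` {t \<in> T. v \<in> t} \<subseteq> {B. B \<subseteq> N \<and> card B = 2}"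
        proof (clarify, intro conjI subsetI)
          fix t assume t: "t \<in> T" and vt: "v \<in> t"
          have ft: "finite t" using T3 [OF t] by (metis card.infinite zero_neq_numeral)
          show "card (t - {v}) = 2" using T3 [OF t] vt ft by simp
          fix u assume u: "u \<in> t - {v}"
          then have "{v, u} \<subseteq> t" "card {v, u} = 2" using vt by auto
          then show "u \<in> N" using TE [OF t] u by (auto simp: N_def)
        qed
        show "finite {B. B \<subseteq> N \<and> card B = 2}" using fN by simp
      qed
      then show ?thesis using n_subsets [OF fN, of 2] cN by simp
    qed
    moreover have "card T \<le> card T' + card {t \<in> T. v \<in> t}"
    proof -
      have "T = T' \<union> {t \<in> T. v \<in> t}" by (auto simp: T'_def)
      then show ?thesis by (metis card_Un_le)
    qed
    moreover have "cap_f (card E') + (d choose 2) \<le> cap_f (card E)"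
      using cap_f_diff [OF dE] cE' by simp
    ultimately show ?thesis by linarith
  qed
qed

section \<open>Leading terms modulo a prime\<close>

text \<open>The positions that are heaviest in the support modulo \<open>p\<close> of some member of
  \<open>Y\<close>. When \<open>Y\<close> is a space of vectors, these play the role of pivots in
  Gaussian elimination.\<close>

definition lead :: "int \<Rightarrow> ('s \<Rightarrow> nat) \<Rightarrow> 's set \<Rightarrow> ('s \<Rightarrow> int) set \<Rightarrow> 's set" where
  "lead p w S Y = {s \<in> S. \<exists>y\<in>Y. \<not> p dvd y s \<and> (\<forall>t\<in>S. w s < w t \<longrightarrow> p dvd y t)}"

lemma lead_subset: "lead p w S Y \<subseteq> S"
  by (auto simp: lead_def)

text \<open>The heaviest position where \<open>y\<close> does not vanish modulo \<open>p\<close> is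
  itself leading.\<close>

lemma lead_zero_imp_zero:
  assumes "finite S" and y: "y \<in> Y" and "\<And>s. s \<in> lead p w S Y \<Longrightarrow> p dvd y s" and s: "s \<in> S"
  shows "p dvd y s"
proof (rule ccontr)
  assume "\<not> p dvd y s"
  then have ne: "{t \<in> S. \<not> p dvd y t} \<noteq> {}" using s by blast
  have fin: "finite {t \<in> S. \<not> p dvd y t}" using assms by simp
  obtain t where t: "t \<in> S" "\<not> p dvd y t" and tmax: "\<And>u. u \<in> S \<Longrightarrow> \<not> p dvd y u \<Longrightarrow> w u \<le> w t"
    using ex_is_arg_min_if_finite [OF fin ne, of "\<lambda>t. - int (w t)"]
    by (auto simp: is_arg_min_linorder)
  then have "t \<in> lead p w S Y" using y unfolding lead_def by fastforce
  then show False using assms t by blast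
qed

lemma ex_scale_mod_prime:
  assumes "Factorial_Ring.prime p" and "\<not> p dvd (a::int)"
  shows "\<exists>c. p dvd b - c * a"
proof -
  have "coprime a p" using prime_imp_coprime [OF assms] by (simp add: coprime_commute)
  then obtain c where "[a * c = 1] (mod p)" using cong_solve_coprime_int by blast
  then have "p dvd 1 - c * a" by (simp add: cong_iff_dvd_diff dvd_diff_commute mult.commute)
  then have "p dvd b * (1 - c * a)" by simp
  then have "p dvd b - (b * c) * a" by (simp add: algebra_simps)
  then show ?thesis by blast
qed

text \<open>Gaussian elimination from heavy to light: a multiple of the witness at a leading
  position corrects the entry there and leaves heavier entries unchanged modulo \<open>p\<close>.
  Consequently \<open>f - y\<close> lives on non-leading positions.\<close>

lemma reduce_mod_lead:
  assumes p: "Factorial_Ring.prime p" and fin: "finite S" and inj: "inj_on w S" and Y0: "y0 \<in> Y"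
    and Y: "\<And>y z c. y \<in> Y \<Longrightarrow> z \<in> Y \<Longrightarrow> (\<lambda>s. y s + c * z s) \<in> Y"
  shows "\<exists>y\<in>Y. \<forall>s\<in>lead p w S Y. p dvd f s - y s"
proof -
  obtain M where M: "\<And>s. s \<in> S \<Longrightarrow> w s < M"
    using finite_nat_set_iff_bounded [of "w ` S"] fin by blast
  \<comment> \<open>After \<open>k\<close> rounds all weights from \<open>M - k\<close> upwards are
    settled. The start is vacuous as \<open>M\<close> exceeds every weight, and at
    \<open>k = M\<close> the bound is zero.\<close>
  have "\<exists>y\<in>Y. \<forall>s\<in>lead p w S Y. M - k \<le> w s \<longrightarrow> p dvd f s - y s" for k
  proof (induction k)
    case 0
    then show ?case using Y0 M by (intro bexI [OF _ Y0]) (fastforce simp: lead_def)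
  next
    case (Suc k)
    then obtain y where y: "y \<in> Y" and yk: "\<And>s. s \<in> lead p w S Y \<Longrightarrow> M - k \<le> w s \<Longrightarrow> p dvd f s - y s"
      by blast
    show ?case
    proof (cases "\<exists>s\<in>lead p w S Y. w s = M - Suc k")
      case False
      then have "M - k \<le> w s" if "s \<in> lead p w S Y" "M - Suc k \<le> w s" for s
        using that by (metis Suc_diff_Suc diff_is_0_eq' le_antisym linorder_not_le not_less_eq_eq zero_le zero_less_diff)
      then show ?thesis using y yk by blast
    next
      case True
      then obtain s z where s: "s \<in> S" "w s = M - Suc k" and z: "z \<in> Y" "\<not> p dvd z s"
        and zt: "\<And>t. t \<in> S \<Longrightarrow> w s < w t \<Longrightarrow> p dvd z t"
        by (auto simp: lead_def)
      obtain c where c: "p dvd (f s - y s) - c * z s"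
        using ex_scale_mod_prime [OF p z(2)] by blast
      have "p dvd f t - (y t + c * z t)" if t: "t \<in> lead p w S Y" "M - Suc k \<le> w t" for t
      proof (cases "w t = M - Suc k")
        case True
        then have "t = s" using inj s t by (auto simp: lead_def inj_on_def)
        then show ?thesis using c by (simp add: algebra_simps)
      next
        case False
        then have "p dvd f t - y t" using t by (intro yk) auto
        moreover have "p dvd z t" using zt [of t] t s False by (auto simp: lead_def)
        ultimately have "p dvd (f t - y t) - c * z t" by simp
        then show ?thesis by (simp add: algebra_simps)
      qed
      then show ?thesis by (intro bexI [OF _ Y [OF y z(1), of c]]) blast
    qed
  qed
  from this [of M] show ?thesis by simp
qed

text \<open>The dimension is at most the number of pivots, by counting: a combination is determined
  modulo \<open>p\<close> by its values at leading positions, so the \<open>p ^ n\<close>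
  coefficient vectors inject into value assignments there.\<close>

lemma card_le_card_lead:
  fixes p :: int and y :: "nat \<Rightarrow> 's \<Rightarrow> int"
  assumes p: "Factorial_Ring.prime p" and fin: "finite S" and Y0: "y0 \<in> Y"
    and Y: "\<And>y z c. y \<in> Y \<Longrightarrow> z \<in> Y \<Longrightarrow> (\<lambda>s. y s + c * z s) \<in> Y"
    and yY: "\<And>k. k < n \<Longrightarrow> y k \<in> Y"
    and indep: "\<And>c k. (\<And>s. s \<in> S \<Longrightarrow> p dvd (\<Sum>k<n. c k * y k s)) \<Longrightarrow> k < n \<Longrightarrow> p dvd c k"
  shows "n \<le> card (lead p w S Y)"
proof -
  let ?L = "lead p w S Y"
  have finL: "finite ?L" by (rule finite_subset [OF lead_subset fin])
  have p2: "p \<ge> 2" using p by (rule prime_ge_2_int)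
  have zero: "(\<lambda>s. 0) \<in> Y" using Y [OF Y0 Y0, of "-1"] by simp
  have comb: "(\<lambda>s. \<Sum>k<m. c k * y k s) \<in> Y" if "m \<le> n" for c m
    using that
  proof (induction m)
    case 0 then show ?case using zero by simp
  next
    case (Suc m)
    then show ?case using Y [OF _ yY, of "\<lambda>s. \<Sum>k<m. c k * y k s" m "c m"] by simp
  qed
  define \<Phi> where "\<Phi> c = restrict (\<lambda>s. (\<Sum>k<n. c k * y k s) mod p) ?L" for c
  have "card ({..<n} \<rightarrow>\<^sub>E {0..<p}) \<le> card (?L \<rightarrow>\<^sub>E {0..<p})"
  proof (rule card_inj_on_le)
    show "\<Phi> ` ({..<n} \<rightarrow>\<^sub>E {0..<p}) \<subseteq> ?L \<rightarrow>\<^sub>E {0..<p}"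
      using p2 unfolding \<Phi>_def by (intro image_subsetI) (simp add: restrict_PiE_iff)
    show "finite (?L \<rightarrow>\<^sub>E {0..<p})" by (intro finite_PiE finL) simp
    show "inj_on \<Phi> ({..<n} \<rightarrow>\<^sub>E {0..<p})"
    proof (rule inj_onI)
      fix c c' assume c: "c \<in> {..<n} \<rightarrow>\<^sub>E {0..<p}" and c': "c' \<in> {..<n} \<rightarrow>\<^sub>E {0..<p}"
        and eq: "\<Phi> c = \<Phi> c'"
      have diff: "(\<Sum>k<n. (c k - c' k) * y k s) = (\<Sum>k<n. c k * y k s) - (\<Sum>k<n. c' k * y k s)" for s
        by (simp add: left_diff_distrib sum_subtractf)
      have dd: "p dvd (\<Sum>k<n. (c k - c' k) * y k s)" if "s \<in> S" for s
      proof (rule lead_zero_imp_zero [OF fin comb [OF order_refl] _ that])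
        fix s assume "s \<in> ?L"
        then have "(\<Sum>k<n. c k * y k s) mod p = (\<Sum>k<n. c' k * y k s) mod p"
          using fun_cong [OF eq, of s] by (simp add: \<Phi>_def)
        then show "p dvd (\<Sum>k<n. (c k - c' k) * y k s)" unfolding diff by (simp add: mod_eq_dvd_iff)
      qed
      have cc: "p dvd c k - c' k" if "k < n" for k
        by (rule indep [of "\<lambda>k. c k - c' k", OF dd that])
      show "c = c'"
      proof (rule PiE_ext [OF c c'])
        fix k assume k: "k \<in> {..<n}"
        then have "c k \<in> {0..<p}" "c' k \<in> {0..<p}" using PiE_mem [OF c] PiE_mem [OF c'] by blast+
        moreover have "c k mod p = c' k mod p" using cc [of k] k by (simp add: mod_eq_dvd_iff)
        ultimately show "c k = c' k" by simp
      qed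
    qed
  qed
  then have "nat p ^ n \<le> nat p ^ card ?L" by (simp add: card_PiE finL)
  then show ?thesis using p2 by (simp add: power_le_imp_le_exp)
qed

section \<open>Alternating forms with slices in a given space\<close>

text \<open>Strictly decreasing index tuples label the basis monomials of the exterior square, and
  below of the exterior cube.\<close>

definition lower_pairs :: "nat \<Rightarrow> (nat \<times> nat) set" where
  "lower_pairs n = {(i, j). j < i \<and> i < n}"

definition lower_triples :: "nat \<Rightarrow> (nat \<times> nat \<times> nat) set" where
  "lower_triples n = {(i, j, l). l < j \<and> j < i \<and> i < n}"

lemma finite_lower_pairs [simp]: "finite (lower_pairs n)"
  by (rule finite_subset [of _ "{..<n} \<times> {..<n}"]) (auto simp: lower_pairs_def)

lemma finite_lower_triples [simp]: "finite (lower_triples n)"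
  by (rule finite_subset [of _ "{..<n} \<times> {..<n} \<times> {..<n}"]) (auto simp: lower_triples_def)

lemma card_lower_pairs: "card (lower_pairs n) = n choose 2"
proof (induction n)
  case 0 show ?case by (simp add: lower_pairs_def numeral_2_eq_2)
next
  case (Suc n)
  have "lower_pairs (Suc n) = lower_pairs n \<union> Pair n ` {..<n}"
    by (auto simp: lower_pairs_def less_Suc_eq)
  moreover have "lower_pairs n \<inter> Pair n ` {..<n} = {}" by (auto simp: lower_pairs_def)
  moreover have "card (Pair n ` {..<n}) = n" by (simp add: card_image inj_on_def)
  ultimately have "card (lower_pairs (Suc n)) = card (lower_pairs n) + n"
    by (simp add: card_Un_disjoint)
  then show ?case using Suc by (simp add: numeral_2_eq_2)
qed

lemma inj_on_pair_set: "inj_on (\<lambda>(i, j). {i, j}) (lower_pairs n)"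
  by (auto simp: inj_on_def lower_pairs_def doubleton_eq_iff)

lemma inj_on_triple_set: "inj_on (\<lambda>(i, j, l). {i, j, l}) (lower_triples n)"
proof -
  have "i = i' \<and> j = j' \<and> l = l'"
    if "l < j" "j < i" "l' < j'" "j' < i'" and eq: "{i, j, l} = {i', j', l'}" for i j l i' j' l' :: nat
  proof -
    have "Max {i, j, l} = i" "Min {i, j, l} = l" using that(1,2) by (auto intro!: Max_eqI Min_eqI)
    moreover have "Max {i', j', l'} = i'" "Min {i', j', l'} = l'"
      using that(3,4) by (auto intro!: Max_eqI Min_eqI)
    ultimately have il: "i = i'" "l = l'" unfolding eq by simp_all
    have "{j} = {i, j, l} - {i, l}" "{j'} = {i', j', l'} - {i', l'}" using that by auto
    then show ?thesis using il eq by auto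
  qed
  then show ?thesis unfolding inj_on_def lower_triples_def by auto
qed

text \<open>Binary encoding of the index set: distinct pairs get distinct weights, and a triple
  weighs as much as any of its pairs plus the power of two of the remaining index.\<close>

definition pair_weight :: "nat \<times> nat \<Rightarrow> nat" where
  "pair_weight = (\<lambda>(i, j). 2 ^ i + 2 ^ j)"

definition triple_weight :: "nat \<times> nat \<times> nat \<Rightarrow> nat" where
  "triple_weight = (\<lambda>(i, j, l). 2 ^ i + 2 ^ j + 2 ^ l)"

lemma inj_on_pair_weight: "inj_on pair_weight (lower_pairs n)"
proof (rule inj_onI)
  fix s t assume st: "s \<in> lower_pairs n" "t \<in> lower_pairs n" and eq: "pair_weight s = pair_weight t"
  have "pair_weight s = set_encode ((\<lambda>(i, j). {i, j}) s)" if "s \<in> lower_pairs n" for s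
    using that by (auto simp: lower_pairs_def pair_weight_def set_encode_def)
  then have "(\<lambda>(i, j). {i, j}) s = (\<lambda>(i, j). {i, j}) t"
    using st eq by (metis (mono_tags, lifting) case_prod_beta finite.emptyI finite.insertI set_encode_eq)
  then show "s = t" using inj_on_pair_set st by (metis (no_types, lifting) inj_onD)
qed

definition ext_by :: "(nat \<Rightarrow> nat \<Rightarrow> int) set \<Rightarrow> (nat \<Rightarrow> nat \<Rightarrow> int) \<Rightarrow> (nat \<Rightarrow> nat \<Rightarrow> int) set" where
  "ext_by R \<alpha> = {\<eta>. \<exists>\<xi>\<in>R. \<exists>c. \<eta> = (\<lambda>i j. \<xi> i j + c * \<alpha> i j)}"

text \<open>Models a subspace of the alternating matrices over the field with \<open>p\<close>
  elements by integer matrices. By \<open>R_cong\<close>, membership depends only on residues of the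
  entries with both indices below \<open>n\<close>.\<close>

locale alternating_forms =
  fixes p :: int and n :: nat and R :: "(nat \<Rightarrow> nat \<Rightarrow> int) set"
  assumes p: "Factorial_Ring.prime p" and odd_p: "odd p"
    and R_zero: "(\<lambda>i j. 0) \<in> R"
    and R_lin: "\<xi> \<in> R \<Longrightarrow> \<zeta> \<in> R \<Longrightarrow> (\<lambda>i j. \<xi> i j + c * \<zeta> i j) \<in> R"
    and R_cong: "\<xi> \<in> R \<Longrightarrow> (\<And>i j. i < n \<Longrightarrow> j < n \<Longrightarrow> p dvd \<zeta> i j - \<xi> i j) \<Longrightarrow> \<zeta> \<in> R"
    and R_anti: "\<xi> \<in> R \<Longrightarrow> i < n \<Longrightarrow> j < n \<Longrightarrow> p dvd \<xi> i j + \<xi> j i"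
begin

lemma R_scale: "\<xi> \<in> R \<Longrightarrow> (\<lambda>i j. c * \<xi> i j) \<in> R"
  using R_lin [OF R_zero, of \<xi> c] by simp

lemma R_sum: "(\<And>k. k < (m :: nat) \<Longrightarrow> \<xi> k \<in> R) \<Longrightarrow> (\<lambda>i j. \<Sum>k<m. c k * \<xi> k i j) \<in> R"
proof (induction m)
  case 0 then show ?case using R_zero by simp
next
  case (Suc m)
  then show ?case using R_lin [of "\<lambda>i j. \<Sum>k<m. c k * \<xi> k i j" "\<xi> m" "c m"] by simp
qed

lemma ext_by_lin:
  assumes "\<eta> \<in> ext_by R \<alpha>" "\<theta> \<in> ext_by R \<alpha>"
  shows "(\<lambda>i j. \<eta> i j + c * \<theta> i j) \<in> ext_by R \<alpha>"
proof -
  obtain \<xi> \<zeta> a b where R: "\<xi> \<in> R" "\<zeta> \<in> R"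
    and eq: "\<eta> = (\<lambda>i j. \<xi> i j + a * \<alpha> i j)" "\<theta> = (\<lambda>i j. \<zeta> i j + b * \<alpha> i j)"
    using assms by (auto simp: ext_by_def)
  show ?thesis
    unfolding ext_by_def eq
    by (intro CollectI bexI [OF _ R_lin [OF R, of c]] exI [of _ "a + c * b"])
       (simp add: algebra_simps)
qed

text \<open>Weights are additive, so contracting with a variable of a leading term keeps it leading.\<close>

lemma le_cap_f_of_not_closed:
  assumes \<alpha>: "\<And>i j. i < n \<Longrightarrow> j < n \<Longrightarrow> p dvd \<alpha> i j + \<alpha> j i" and "\<alpha> \<notin> R"
    and ex: "\<And>k. k < n \<Longrightarrow> \<exists>\<xi>. (\<forall>l. \<xi> l \<in> R) \<and> (\<forall>i<n. \<forall>j<n. \<forall>l<n.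
      p dvd (\<alpha> i j * of_bool (l = k) - of_bool (i = k) * \<alpha> j l) - (\<xi> l i j - \<xi> i j l))"
  shows "n \<le> cap_f (card (lead p pair_weight (lower_pairs n) (case_prod ` ext_by R \<alpha>)))"
proof -
  let ?Z = "ext_by R \<alpha>"
  have "\<forall>k\<in>{..<n}. \<exists>\<xi>. (\<forall>l. \<xi> l \<in> R) \<and> (\<forall>i<n. \<forall>j<n. \<forall>l<n.
      p dvd (\<alpha> i j * of_bool (l = k) - of_bool (i = k) * \<alpha> j l) - (\<xi> l i j - \<xi> i j l))"
    using ex by simp
  from bchoice [OF this] obtain \<xi> where \<xi>_ex: "\<forall>k\<in>{..<n}. (\<forall>l. \<xi> k l \<in> R) \<and> (\<forall>i<n. \<forall>j<n. \<forall>l<n.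
      p dvd (\<alpha> i j * of_bool (l = k) - of_bool (i = k) * \<alpha> j l) - (\<xi> k l i j - \<xi> k i j l))" ..
  have \<xi>R: "\<xi> k l \<in> R" if "k < n" for k l using \<xi>_ex that by blast
  have \<xi>: "p dvd (\<alpha> i j * of_bool (l = k) - of_bool (i = k) * \<alpha> j l) - (\<xi> k l i j - \<xi> k i j l)"
    if "k < n" "i < n" "j < n" "l < n" for k i j l using \<xi>_ex that by blast
  \<comment> \<open>The \<open>k\<close>-th three-form: its slice at \<open>l\<close> is
    \<open>\<alpha>\<close> (if \<open>l = k\<close>) or zero, minus
    \<open>\<xi> k l\<close>.\<close>
  define y where "y k = (\<lambda>i j l. \<alpha> i j * of_bool (l = k) - \<xi> k l i j)" for k
  \<comment> \<open>Cyclic invariance and a sign change under one transposition make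
    \<open>y\<close> alternating modulo \<open>p\<close>; the last clause puts every slice into the
    space spanned by \<open>R\<close> and \<open>\<alpha>\<close>.\<close>
  define Y where "Y = {y :: nat \<Rightarrow> nat \<Rightarrow> nat \<Rightarrow> int.
    (\<forall>i<n. \<forall>j<n. \<forall>l<n. p dvd y i j l - y j l i \<and> p dvd y i j l + y j i l) \<and>
    (\<forall>l<n. (\<lambda>i j. y i j l) \<in> ?Z)}"
  define U where "U = (\<lambda>y (i, j, l). y i j l :: int) ` Y"
  let ?L3 = "lead p triple_weight (lower_triples n) U"
  let ?L2 = "lead p pair_weight (lower_pairs n) (case_prod ` ?Z)"

  have Y_cyc: "p dvd z i j l \<longleftrightarrow> p dvd z j l i" if "z \<in> Y" "i < n" "j < n" "l < n" for z i j l
  proof -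
    have "p dvd z i j l - z j l i" using that unfolding Y_def by blast
    then show ?thesis by (metis dvd_diff_right_iff dvd_diff_left_iff)
  qed
  have Y_anti: "p dvd z i j l \<longleftrightarrow> p dvd z j i l" if "z \<in> Y" "i < n" "j < n" "l < n" for z i j l
  proof -
    have "p dvd z i j l + z j i l" using that unfolding Y_def by blast
    then show ?thesis by (metis dvd_add_right_iff dvd_add_left_iff)
  qed
  have Y_diag: "p dvd z i i l" if "z \<in> Y" "i < n" "l < n" for z i l
  proof -
    have "p dvd z i i l + z i i l" using that unfolding Y_def by blast
    then have "p dvd 2 * z i i l" by simp
    moreover have "\<not> p dvd 2"
      using p odd_p prime_ge_2_int [OF p] zdvd_imp_le [of p 2] by auto
    ultimately show ?thesis using p prime_dvd_mult_iff by blast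
  qed
  have Y_slice: "(\<lambda>(i, j). z i j l) \<in> case_prod ` ?Z" if "z \<in> Y" "l < n" for z l
    using that unfolding Y_def by blast
  \<comment> \<open>Entries of an alternating form reduce to decreasing positions. The multiset
    equation in \<open>P\<close> transports weight information from \<open>a\<close>,
    \<open>b\<close>, \<open>c\<close> to the sorted triple.\<close>
  have Y_all: "p dvd z a b c"
    if z: "z \<in> Y" and abc: "a < n" "b < n" "c < n"
      and P: "\<And>i j l. l < j \<Longrightarrow> j < i \<Longrightarrow> i < n \<Longrightarrow> {#i, j, l#} = {#a, b, c#} \<Longrightarrow> p dvd z i j l" for z a b c
  proof -
    note cyc = Y_cyc [OF z] and anti = Y_anti [OF z] and diag = Y_diag [OF z]
    consider "a = b" | "b = c" | "a = c" | "c < b" "b < a" | "b < c" "c < a" | "c < a" "a < b"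
      | "a < c" "c < b" | "b < a" "a < c" | "a < b" "b < c"
      by linarith
    then show ?thesis
    proof cases
      case 1 then show ?thesis using diag abc by simp
    next
      case 2 then show ?thesis using cyc [of a b c] diag [of b a] abc by simp
    next
      case 3 then show ?thesis using cyc [of a b c] cyc [of b c a] diag [of a b] abc by simp
    next
      case 4 then show ?thesis using P [of c b a] abc by simp
    next
      case 5
      have "p dvd z a c b" using 5 abc by (intro P) (auto simp: add_mset_commute)
      then show ?thesis using cyc [of a b c] cyc [of b c a] anti [of a c b] abc by simp
    next
      case 6
      have "p dvd z b a c" using 6 abc by (intro P) (auto simp: add_mset_commute)
      then show ?thesis using anti [of a b c] abc by simp
    next
      case 7
      have "p dvd z b c a" using 7 abc by (intro P) (auto simp: add_mset_commute)
      then show ?thesis using cyc [of a b c] abc by simp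
    next
      case 8
      have "p dvd z c a b" using 8 abc by (intro P) (auto simp: add_mset_commute)
      then show ?thesis using cyc [of a b c] cyc [of b c a] abc by simp
    next
      case 9
      have "p dvd z c b a" using 9 abc by (intro P) (auto simp: add_mset_commute)
      then show ?thesis using cyc [of a b c] anti [of b c a] abc by simp
    qed
  qed

  have Y_zero: "(\<lambda>i j l. 0) \<in> Y"
    unfolding Y_def ext_by_def using R_zero by (auto intro!: bexI [OF _ R_zero] exI [of _ 0])
  have Y_lin: "(\<lambda>i j l. u i j l + c * v i j l) \<in> Y" if uv: "u \<in> Y" "v \<in> Y" for u v c
    unfolding Y_def
  proof (intro CollectI conjI allI impI)
    fix i j l assume "i < n" "j < n" "l < n"
    then have "p dvd u i j l - u j l i" "p dvd v i j l - v j l i" "p dvd u i j l + u j i l" "p dvd v i j l + v j i l"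
      using uv unfolding Y_def by blast+
    then have "p dvd (u i j l - u j l i) + c * (v i j l - v j l i)"
      "p dvd (u i j l + u j i l) + c * (v i j l + v j i l)" by simp_all
    then show "p dvd u i j l + c * v i j l - (u j l i + c * v j l i)"
      "p dvd u i j l + c * v i j l + (u j i l + c * v j i l)" by (simp_all add: algebra_simps)
  next
    fix l assume "l < n"
    then show "(\<lambda>i j. u i j l + c * v i j l) \<in> ?Z"
      using uv unfolding Y_def by (intro ext_by_lin) blast+
  qed
  have y_Y: "y k \<in> Y" if k: "k < n" for k
    unfolding Y_def
  proof (intro CollectI conjI allI impI)
    fix i j l assume ijl: "i < n" "j < n" "l < n"
    \<comment> \<open>The identity assumed in \<open>ex\<close> is precisely the cyclic invariance
      of \<open>y k\<close>.\<close>
    show "p dvd y k i j l - y k j l i"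
      using \<xi> [OF k ijl] by (simp add: y_def algebra_simps)
    have "p dvd (\<alpha> i j + \<alpha> j i) * of_bool (l = k) - (\<xi> k l i j + \<xi> k l j i)"
      using \<alpha> [OF ijl(1,2)] R_anti [OF \<xi>R [OF k] ijl(1,2)] by (intro dvd_diff dvd_mult2)
    then show "p dvd y k i j l + y k j i l" by (simp add: y_def algebra_simps)
  next
    fix l
    have "(\<lambda>i j. y k i j l) = (\<lambda>i j. (-1) * \<xi> k l i j + of_bool (l = k) * \<alpha> i j)"
      by (simp add: y_def fun_eq_iff)
    then show "(\<lambda>i j. y k i j l) \<in> ?Z"
      unfolding ext_by_def by (intro CollectI bexI [OF _ R_scale [OF \<xi>R [OF k], of "-1"]] exI)
  qed

  have "n \<le> card ?L3"
  proof (rule card_le_card_lead [OF p finite_lower_triples, where y = "\<lambda>k (i, j, l). y k i j l"])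
    show "(\<lambda>(i, j, l). 0) \<in> U" unfolding U_def by (rule image_eqI [OF _ Y_zero]) simp
  next
    fix s t c assume "s \<in> U" "t \<in> U"
    then obtain u v where uv: "u \<in> Y" "v \<in> Y" and st: "s = (\<lambda>(i, j, l). u i j l)" "t = (\<lambda>(i, j, l). v i j l)"
      by (auto simp: U_def)
    have "(\<lambda>i j l. u i j l + c * v i j l) \<in> Y" by (rule Y_lin [OF uv])
    then show "(\<lambda>a. s a + c * t a) \<in> U" unfolding U_def st by (rule rev_image_eqI) auto
  next
    fix k assume k: "k < n"
    show "(\<lambda>(i, j, l). y k i j l) \<in> U" unfolding U_def by (rule image_eqI [OF _ y_Y [OF k]]) simp
  next
    fix c :: "nat \<Rightarrow> int" and k
    assume van: "\<And>s. s \<in> lower_triples n \<Longrightarrow> p dvd (\<Sum>k<n. c k * (case s of (i, j, l) \<Rightarrow> y k i j l))" and k: "k < n"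
    define z where "z = (\<lambda>i j l. \<Sum>m<n. c m * y m i j l)"
    have "(\<lambda>i j l. \<Sum>m<N. c m * y m i j l) \<in> Y" if "N \<le> n" for N
      using that
    proof (induction N)
      case 0 then show ?case using Y_zero by simp
    next
      case (Suc N)
      then show ?case using Y_lin [OF _ y_Y, of "\<lambda>i j l. \<Sum>m<N. c m * y m i j l" N "c N"] by simp
    qed
    then have "z \<in> Y" unfolding z_def by blast
    then have z: "p dvd z i j l" if "i < n" "j < n" "l < n" for i j l
    proof (rule Y_all [OF _ that])
      fix i j l :: nat assume "l < j" "j < i" "i < n"
      then show "p dvd z i j l" using van [of "(i, j, l)"] by (simp add: z_def lower_triples_def)
    qed
    \<comment> \<open>The slice at \<open>k\<close> of the vanishing combination \<open>z\<close> is
      \<open>c k\<close> times \<open>\<alpha>\<close> minus a member of \<open>R\<close>. Hence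
      \<open>c k * \<alpha>\<close> lies in \<open>R\<close>, and inverting \<open>c k\<close>
      modulo \<open>p\<close> would put \<open>\<alpha>\<close> there too.\<close>
    have sum: "(\<lambda>i j. \<Sum>m<n. c m * \<xi> m k i j) \<in> R" by (rule R_sum) (rule \<xi>R)
    have c\<alpha>: "(\<lambda>i j. c k * \<alpha> i j) \<in> R"
    proof (rule R_cong [OF sum])
      fix i j assume ij: "i < n" "j < n"
      have "z i j k = (\<Sum>m<n. c m * \<alpha> i j * of_bool (k = m)) - (\<Sum>m<n. c m * \<xi> m k i j)"
        by (simp add: z_def y_def right_diff_distrib sum_subtractf mult.assoc)
      also have "(\<Sum>m<n. c m * \<alpha> i j * of_bool (k = m)) = c k * \<alpha> i j"
        using k by (simp add: of_bool_def sum.delta if_distrib cong: if_cong)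
      finally show "p dvd c k * \<alpha> i j - (\<Sum>m<n. c m * \<xi> m k i j)" using z [OF ij k] by simp
    qed
    show "p dvd c k"
    proof (rule ccontr)
      assume "\<not> p dvd c k"
      then obtain e where e: "p dvd 1 - e * c k" using ex_scale_mod_prime [OF p] by blast
      have "\<alpha> \<in> R"
      proof (rule R_cong [OF R_scale [OF c\<alpha>, of e]])
        fix i j
        have "p dvd (1 - e * c k) * \<alpha> i j" using e by (rule dvd_mult2)
        then show "p dvd \<alpha> i j - e * (c k * \<alpha> i j)" by (simp add: algebra_simps)
      qed
      then show False using \<open>\<alpha> \<notin> R\<close> by blast
    qed
  qed
  moreover have "card ?L3 \<le> cap_f (card ?L2)"
  proof -
    define E where "E = (\<lambda>(i, j). {i, j}) ` ?L2"
    define T where "T = (\<lambda>(i, j, l). {i, j, l}) ` ?L3"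
    \<comment> \<open>All three edges of a leading triple are leading pairs: fixing one index of
      \<open>z\<close> gives a slice whose heaviest pair consists of the other two.\<close>
    have face: "(i, j) \<in> ?L2 \<and> (i, l) \<in> ?L2 \<and> (j, l) \<in> ?L2" if ijl: "(i, j, l) \<in> ?L3" for i j l
    proof -
      have lt: "l < j" "j < i" "i < n" using that by (auto simp: lead_def lower_triples_def)
      obtain z where z: "z \<in> Y" "\<not> p dvd z i j l"
        and zt': "\<forall>t\<in>lower_triples n. triple_weight (i, j, l) < triple_weight t \<longrightarrow>
          p dvd (case t of (i, j, l) \<Rightarrow> z i j l)"
        using ijl by (auto simp: lead_def U_def)
      have zt: "p dvd z i' j' l'" if "l' < j'" "j' < i'" "i' < n"
          "triple_weight (i, j, l) < triple_weight (i', j', l')" for i' j' l'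
        using bspec [OF zt', of "(i', j', l')"] that by (simp add: lower_triples_def)
      \<comment> \<open>The weight of a triple ignores the order of its indices, so vanishing at
        heavier positions extends from decreasing to arbitrary triples.\<close>
      have big: "p dvd z a b c" if "a < n" "b < n" "c < n" "(2::nat) ^ i + 2 ^ j + 2 ^ l < 2 ^ a + 2 ^ b + 2 ^ c" for a b c
      proof (rule Y_all [OF z(1) that(1-3)])
        fix i' j' l' assume lt': "l' < j'" "j' < i'" "i' < n" and eq: "{#i', j', l'#} = {#a, b, c#}"
        have "sum_mset (image_mset (\<lambda>u. (2::nat) ^ u) {#i', j', l'#}) = sum_mset (image_mset (\<lambda>u. 2 ^ u) {#a, b, c#})"
          unfolding eq ..
        then show "p dvd z i' j' l'" using that(4) lt' by (intro zt) (auto simp: triple_weight_def)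
      qed
      have ln: "l < n" "j < n" using lt by simp_all
      \<comment> \<open>Slices fix the third index, so the symmetries of \<open>z\<close> first move
        the index to be dropped into the last place.\<close>
      have nz2: "\<not> p dvd z j l i" using Y_cyc [OF z(1) lt(3) ln(2,1)] z(2) by blast
      then have nz1: "\<not> p dvd z i l j"
        using Y_cyc [OF z(1) lt(3) ln] Y_anti [OF z(1) ln lt(3)] by blast
      have lead2: "(a, b) \<in> ?L2" if "b < a" "a < n" "c < n" "\<not> p dvd z a b c"
        "(2::nat) ^ a + 2 ^ b + 2 ^ c = 2 ^ i + 2 ^ j + 2 ^ l" for a b c
        unfolding lead_def
      proof (intro CollectI conjI bexI [OF _ Y_slice [OF z(1) that(3)]] ballI impI)
        fix t assume "t \<in> lower_pairs n" "pair_weight (a, b) < pair_weight t"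
        then show "p dvd (case t of (i, j) \<Rightarrow> z i j c)"
          using that by (auto simp: lower_pairs_def pair_weight_def intro!: big)
      qed (use that in \<open>auto simp: lower_pairs_def\<close>)
      have "l < i" using lt by simp
      show ?thesis
        using lead2 [OF lt(2,3) ln(1) z(2)] lead2 [OF \<open>l < i\<close> lt(3) ln(2) nz1] lead2 [OF lt(1) ln(2) lt(3) nz2]
        by (simp add: add_ac)
    qed
    have "card T \<le> cap_f (card E)"
    proof (rule card_triangles_le_cap_f)
      show "finite E" unfolding E_def by (intro finite_imageI finite_subset [OF lead_subset]) simp
      show "card e = 2" if "e \<in> E" for e
        using that by (auto simp: E_def lead_def lower_pairs_def)
      show "card t = 3" if "t \<in> T" for t
        using that by (auto simp: T_def lead_def lower_triples_def)
      fix t e assume t: "t \<in> T" and e: "e \<subseteq> t" "card e = 2"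
      obtain i j l where ijl: "(i, j, l) \<in> ?L3" and teq: "t = {i, j, l}" using t by (auto simp: T_def)
      obtain a b where ab: "e = {a, b}" "a \<noteq> b" using e(2) by (auto simp: card_2_iff)
      have "e = {i, j} \<or> e = {i, l} \<or> e = {j, l}" using e(1) ab unfolding teq by auto
      then show "e \<in> E" using face [OF ijl] unfolding E_def by force
    qed
    moreover have "card T = card ?L3"
      unfolding T_def by (intro card_image inj_on_subset [OF inj_on_triple_set lead_subset])
    moreover have "card E = card ?L2"
      unfolding E_def by (intro card_image inj_on_subset [OF inj_on_pair_set lead_subset])
    ultimately show ?thesis by simp
  qed
  ultimately show ?thesis by linarith
qed

end

section \<open>Ordered products and class two\<close>

primrec gprod :: "('a, 'b) monoid_scheme \<Rightarrow> (nat \<Rightarrow> 'a) \<Rightarrow> (nat \<Rightarrow> int) \<Rightarrow> nat \<Rightarrow> 'a" where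
  "gprod G x a 0 = \<one>\<^bsub>G\<^esub>"
| "gprod G x a (Suc k) = gprod G x a k \<otimes>\<^bsub>G\<^esub> x k [^]\<^bsub>G\<^esub> a k"

lemma (in group) gprod_closed [simp]:
  "(\<And>i. i < k \<Longrightarrow> x i \<in> carrier G) \<Longrightarrow> gprod G x a k \<in> carrier G"
  by (induction k) auto

lemma gprod_cong:
  "(\<And>i. i < k \<Longrightarrow> x i [^]\<^bsub>G\<^esub> a i = y i [^]\<^bsub>G\<^esub> b i) \<Longrightarrow> gprod G x a k = gprod G y b k"
  by (induction k) auto

lemma (in group_hom) hom_gprod:
  "(\<And>i. i < k \<Longrightarrow> x i \<in> carrier G) \<Longrightarrow> h (gprod G x a k) = gprod H (\<lambda>i. h (x i)) a k"
  by (induction k) (auto simp: hom_int_pow)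

lemma (in group) int_pow_cong_exponent:
  assumes x: "x \<in> carrier G" and xp: "x [^] (int p) = \<one>" and ab: "int p dvd a - b"
  shows "x [^] a = x [^] b"
proof -
  obtain c where c: "a - b = int p * c" using ab by (elim dvdE)
  then have "x [^] a = x [^] (int p * c + b)" by (simp add: algebra_simps)
  also have "\<dots> = (x [^] int p) [^] c \<otimes> x [^] b" using x by (simp add: int_pow_mult int_pow_pow)
  finally show ?thesis using x xp by simp
qed

text \<open>Translates a vector-space basis into group language: linear combinations become ordered
  products of powers, and independence becomes divisibility of exponents.\<close>

lemma has_rank_basis:
  assumes p: "Factorial_Ring.prime p" and A: "comm_group A"
    and ex: "\<And>x. x \<in> carrier A \<Longrightarrow> x [^]\<^bsub>A\<^esub> p = \<one>\<^bsub>A\<^esub>" and rank: "has_rank p A r"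
  obtains b where "\<And>i. i < r \<Longrightarrow> b i \<in> carrier A"
    and "\<And>g. g \<in> carrier A \<Longrightarrow> \<exists>c. g = gprod A b c r"
    and "\<And>c i. gprod A b c r = \<one>\<^bsub>A\<^esub> \<Longrightarrow> i < r \<Longrightarrow> int p dvd c i"
proof -
  interpret A: comm_group A by (rule A)
  let ?K = "residue_ring (int p)" and ?V = "power_module A"
  interpret V: vectorspace ?K ?V by (rule vectorspace_power_module [OF p A ex])
  have cV: "carrier ?V = carrier A" by (simp add: power_module_def)
  have cK: "carrier ?K = {0..int p - 1}" by (simp add: residue_ring_def)
  have p0: "int p > 0" using p by (simp add: prime_gt_0_nat)
  obtain B where B: "finite B" "V.basis B"
    using V.finite_basis_exists rank by (auto simp: has_rank_def)
  then have cB: "card B = r" using V.dim_basis rank by (auto simp: has_rank_def)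
  have BV: "B \<subseteq> carrier A" using B cV by (auto simp: V.basis_def)
  obtain b where bB: "bij_betw b {..<r} B"
    using ex_bij_betw_nat_finite [OF B(1)] cB by (auto simp: lessThan_atLeast0)
  have bA: "b i \<in> carrier A" if "i < r" for i
    using bB BV that by (auto simp: bij_betw_def)
  have sum: "finsum ?V (\<lambda>i. c i \<odot>\<^bsub>?V\<^esub> b i) {..<k} = gprod A b c k" if "k \<le> r" for c k
    using that
  proof (induction k)
    case 0 show ?case unfolding lessThan_0 V.finsum_empty by (simp add: power_module_def)
  next
    case (Suc k)
    have "finsum ?V (\<lambda>i. c i \<odot>\<^bsub>?V\<^esub> b i) {..<Suc k} =
        c k \<odot>\<^bsub>?V\<^esub> b k \<oplus>\<^bsub>?V\<^esub> finsum ?V (\<lambda>i. c i \<odot>\<^bsub>?V\<^esub> b i) {..<k}"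
      unfolding lessThan_Suc using Suc.prems bA
      by (intro V.finsum_insert) (auto simp: power_module_def)
    also have "\<dots> = b k [^]\<^bsub>A\<^esub> c k \<otimes>\<^bsub>A\<^esub> gprod A b c k"
      using Suc by (simp add: power_module_def)
    also have "\<dots> = gprod A b c (Suc k)" using Suc.prems bA by (simp add: A.m_comm)
    finally show ?case .
  qed
  have lin: "V.lincomb a B = gprod A b (\<lambda>i. a (b i)) r" for a
  proof -
    have "V.lincomb a B = finsum ?V (\<lambda>v. a v \<odot>\<^bsub>?V\<^esub> v) (b ` {..<r})"
      using bB by (simp add: V.lincomb_def bij_betw_def)
    also have "\<dots> = finsum ?V (\<lambda>i. a (b i) \<odot>\<^bsub>?V\<^esub> b i) {..<r}"
      using bB bA by (intro V.finsum_reindex) (auto simp: bij_betw_def power_module_def)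
    finally show ?thesis by (simp add: sum)
  qed
  have crit: "\<exists>!a. a \<in> B \<rightarrow>\<^sub>E carrier ?K \<and> V.lincomb a B = v" if "v \<in> carrier A" for v
    using V.basis_criterion [OF B(1)] B(2) BV that cV by auto
  show thesis
  proof
    show "b i \<in> carrier A" if "i < r" for i by (rule bA [OF that])
    show "\<exists>c. g = gprod A b c r" if "g \<in> carrier A" for g
      using crit [OF that] lin by metis
    fix c i assume c: "gprod A b c r = \<one>\<^bsub>A\<^esub>" and i: "i < r"
    \<comment> \<open>\<open>basis_criterion\<close> speaks of residues extended by
      \<open>undefined\<close> off \<open>B\<close>. The reduced exponents \<open>a\<close> and the
      zero coordinates \<open>z\<close> are both of this shape, and uniqueness identifies
      them.\<close>
    define a where "a v = (if v \<in> B then c (the_inv_into {..<r} b v) mod int p else undefined)" for v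
    define z where "z v = (if v \<in> B then 0 else (undefined :: int))" for v
    have bi: "b i \<in> B" if "i < r" for i using bB that by (auto simp: bij_betw_def)
    have ab: "a (b i) = c i mod int p" if "i < r" for i
      using bB bi that by (auto simp: a_def bij_betw_def the_inv_into_f_f)
    have "V.lincomb a B = gprod A b c r"
      unfolding lin
    proof (rule gprod_cong)
      fix i assume i: "i < r"
      show "b i [^]\<^bsub>A\<^esub> a (b i) = b i [^]\<^bsub>A\<^esub> c i"
        unfolding ab [OF i] using bA [OF i] ex [OF bA [OF i]]
        by (intro A.int_pow_cong_exponent [of _ p]) (auto simp: int_pow_int mod_eq_dvd_iff [symmetric])
    qed
    moreover have "V.lincomb z B = \<one>\<^bsub>A\<^esub>"
    proof -
      have "gprod A b (\<lambda>i. z (b i)) k = \<one>\<^bsub>A\<^esub>" if "k \<le> r" for k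
        using that by (induction k) (auto simp: z_def bi)
      then show ?thesis unfolding lin by simp
    qed
    moreover have "a \<in> B \<rightarrow>\<^sub>E carrier ?K" "z \<in> B \<rightarrow>\<^sub>E carrier ?K"
      using p0 by (auto simp: a_def z_def cK)
    ultimately have "a = z" using crit [OF A.one_closed] c by metis
    then have "c i mod int p = 0" using ab [OF i] bi [OF i] by (simp add: z_def)
    then show "int p dvd c i" by auto
  qed
qed

section \<open>Commutator calculus in class two\<close>

definition comm :: "('a, 'b) monoid_scheme \<Rightarrow> 'a \<Rightarrow> 'a \<Rightarrow> 'a" where
  "comm G x y = x \<otimes>\<^bsub>G\<^esub> y \<otimes>\<^bsub>G\<^esub> inv\<^bsub>G\<^esub> x \<otimes>\<^bsub>G\<^esub> inv\<^bsub>G\<^esub> y"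

lemma (in group) comm_closed [simp]:
  "x \<in> carrier G \<Longrightarrow> y \<in> carrier G \<Longrightarrow> comm G x y \<in> carrier G"
  by (simp add: comm_def)

lemma (in group) comm_swap:
  assumes "x \<in> carrier G" "y \<in> carrier G"
  shows "x \<otimes> y = comm G x y \<otimes> (y \<otimes> x)"
  using assms by (simp add: comm_def m_assoc inv_solve_left' [symmetric]) (simp add: m_assoc [symmetric])

lemma (in group) comm_eqI:
  assumes "x \<in> carrier G" "y \<in> carrier G" "c \<in> carrier G" and "x \<otimes> y = c \<otimes> (y \<otimes> x)"
  shows "comm G x y = c"
  using assms comm_swap by (metis comm_closed m_closed right_cancel)

lemma (in group) center_closed: "z \<in> center G \<Longrightarrow> z \<in> carrier G"
  by (simp add: center_def)

lemma (in group) center_commute: "z \<in> center G \<Longrightarrow> x \<in> carrier G \<Longrightarrow> x \<otimes> z = z \<otimes> x"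
  by (simp add: center_def)

lemma (in group) gprod_in_subgroup:
  assumes "subgroup H G" "\<And>i. i < k \<Longrightarrow> x i \<in> H"
  shows "gprod G x a k \<in> H"
  using assms(2)
  by (induction k) (auto simp: assms(1) subgroup.one_closed subgroup.m_closed subgroup_int_pow_closed)

lemma (in group) gprod_add:
  assumes x: "\<And>i. i < k \<Longrightarrow> x i \<in> center G"
  shows "gprod G x (\<lambda>i. a i + b i) k = gprod G x a k \<otimes> gprod G x b k"
  using assms
proof (induction k)
  case 0 then show ?case by simp
next
  case (Suc k)
  have x: "x i \<in> carrier G" if "i < Suc k" for i using Suc.prems that by (simp add: center_closed)
  have xa: "x k [^] a k \<in> center G"
    using Suc.prems by (simp add: subgroup_int_pow_closed [OF center_subgroup])
  have g: "gprod G x a k \<in> carrier G" "gprod G x b k \<in> carrier G" using x by simp_all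
  have "gprod G x (\<lambda>i. a i + b i) (Suc k) =
      gprod G x a k \<otimes> (gprod G x b k \<otimes> x k [^] a k) \<otimes> x k [^] b k"
    using Suc x g by (simp add: int_pow_mult m_assoc)
  also have "gprod G x b k \<otimes> x k [^] a k = x k [^] a k \<otimes> gprod G x b k"
    using center_commute [OF xa g(2)] .
  finally show ?case using x g by (simp add: m_assoc)
qed

locale class2_group = group G for G (structure) +
  assumes comm_center: "x \<in> carrier G \<Longrightarrow> y \<in> carrier G \<Longrightarrow> comm G x y \<in> center G"
begin

text \<open>Central commutators slide past all other factors. Together with the companion for the
  second argument this makes \<open>comm\<close> bimultiplicative.\<close>

lemma comm_mult_left:
  assumes "x \<in> carrier G" "y \<in> carrier G" "z \<in> carrier G"
  shows "comm G (x \<otimes> y) z = comm G x z \<otimes> comm G y z"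
proof (rule comm_eqI)
  have "x \<otimes> y \<otimes> z = x \<otimes> comm G y z \<otimes> (z \<otimes> y)"
    using assms comm_swap [of y z] by (simp add: m_assoc)
  also have "x \<otimes> comm G y z = comm G y z \<otimes> x" using assms by (intro center_commute comm_center)
  also have "comm G y z \<otimes> x \<otimes> (z \<otimes> y) = comm G y z \<otimes> (x \<otimes> z) \<otimes> y" using assms by (simp add: m_assoc)
  also have "x \<otimes> z = comm G x z \<otimes> (z \<otimes> x)" using assms by (intro comm_swap)
  also have "comm G y z \<otimes> (comm G x z \<otimes> (z \<otimes> x)) \<otimes> y = (comm G y z \<otimes> comm G x z) \<otimes> (z \<otimes> (x \<otimes> y))"
    using assms by (simp add: m_assoc)
  also have "comm G y z \<otimes> comm G x z = comm G x z \<otimes> comm G y z"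
    using assms by (intro center_commute comm_center comm_closed)
  finally show "x \<otimes> y \<otimes> z = comm G x z \<otimes> comm G y z \<otimes> (z \<otimes> (x \<otimes> y))" .
qed (use assms in auto)

lemma comm_mult_right:
  assumes "x \<in> carrier G" "y \<in> carrier G" "z \<in> carrier G"
  shows "comm G x (y \<otimes> z) = comm G x y \<otimes> comm G x z"
proof (rule comm_eqI)
  have "x \<otimes> (y \<otimes> z) = (x \<otimes> y) \<otimes> z" using assms by (simp add: m_assoc)
  also have "x \<otimes> y = comm G x y \<otimes> (y \<otimes> x)" using assms by (intro comm_swap)
  also have "comm G x y \<otimes> (y \<otimes> x) \<otimes> z = comm G x y \<otimes> y \<otimes> (x \<otimes> z)" using assms by (simp add: m_assoc)
  also have "x \<otimes> z = comm G x z \<otimes> (z \<otimes> x)" using assms by (intro comm_swap)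
  also have "comm G x y \<otimes> y \<otimes> (comm G x z \<otimes> (z \<otimes> x)) = comm G x y \<otimes> (y \<otimes> comm G x z) \<otimes> (z \<otimes> x)"
    using assms by (simp add: m_assoc)
  also have "y \<otimes> comm G x z = comm G x z \<otimes> y" using assms by (intro center_commute comm_center)
  finally show "x \<otimes> (y \<otimes> z) = comm G x y \<otimes> comm G x z \<otimes> (y \<otimes> z \<otimes> x)" using assms by (simp add: m_assoc)
qed (use assms in auto)

lemma comm_hom_left: "z \<in> carrier G \<Longrightarrow> group_hom G G (\<lambda>x. comm G x z)"
  by unfold_locales (auto simp: hom_def comm_mult_left)

lemma comm_hom_right: "z \<in> carrier G \<Longrightarrow> group_hom G G (comm G z)"
  by unfold_locales (auto simp: hom_def comm_mult_right)

text \<open>The value in the commutator subgroup of the two-form \<open>\<alpha>\<close>, with the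
  basis replaced by \<open>x\<close>. Only entries strictly below the diagonal are read.\<close>

fun cprod :: "(nat \<Rightarrow> 'a) \<Rightarrow> (nat \<Rightarrow> nat \<Rightarrow> int) \<Rightarrow> nat \<Rightarrow> 'a" where
  "cprod x \<alpha> 0 = \<one>"
| "cprod x \<alpha> (Suc k) = cprod x \<alpha> k \<otimes> gprod G (\<lambda>j. comm G (x k) (x j)) (\<alpha> k) k"

lemma cprod_in_subgroup:
  assumes "subgroup H G" "\<And>i j. j < i \<Longrightarrow> i < k \<Longrightarrow> comm G (x i) (x j) \<in> H"
  shows "cprod x \<alpha> k \<in> H"
  using assms(2)
proof (induction k)
  case 0 then show ?case by (simp add: assms(1) subgroup.one_closed)
next
  case (Suc k)
  then have "gprod G (\<lambda>j. comm G (x k) (x j)) (\<alpha> k) k \<in> H"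
    by (intro gprod_in_subgroup assms(1)) auto
  then show ?case using Suc by (auto intro!: subgroup.m_closed [OF assms(1)])
qed

lemma cprod_center: "(\<And>i. i < k \<Longrightarrow> x i \<in> carrier G) \<Longrightarrow> cprod x \<alpha> k \<in> center G"
  by (rule cprod_in_subgroup [OF center_subgroup]) (auto intro: comm_center)

lemma cprod_closed [simp]: "(\<And>i. i < k \<Longrightarrow> x i \<in> carrier G) \<Longrightarrow> cprod x \<alpha> k \<in> carrier G"
  by (rule center_closed [OF cprod_center])

lemma cprod_add:
  assumes x: "\<And>i. i < k \<Longrightarrow> x i \<in> carrier G"
  shows "cprod x (\<lambda>i j. \<alpha> i j + \<beta> i j) k = cprod x \<alpha> k \<otimes> cprod x \<beta> k"
  using assms
proof (induction k)
  case 0 then show ?case by simp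
next
  case (Suc k)
  let ?g = "\<lambda>\<alpha>. gprod G (\<lambda>j. comm G (x k) (x j)) (\<alpha> k) k"
  have g: "?g \<alpha> \<in> carrier G" for \<alpha> using Suc.prems by simp
  have c: "cprod x \<alpha> k \<in> carrier G" for \<alpha> using Suc.prems by simp
  have c': "cprod x \<alpha> k \<in> center G" for \<alpha> using Suc.prems by (simp add: cprod_center)
  have "?g (\<lambda>i j. \<alpha> i j + \<beta> i j) = ?g \<alpha> \<otimes> ?g \<beta>"
    using Suc.prems by (intro gprod_add comm_center) auto
  then have "cprod x (\<lambda>i j. \<alpha> i j + \<beta> i j) (Suc k) = cprod x \<alpha> k \<otimes> (cprod x \<beta> k \<otimes> ?g \<alpha>) \<otimes> ?g \<beta>"
    using Suc g c by (simp add: m_assoc)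
  also have "cprod x \<beta> k \<otimes> ?g \<alpha> = ?g \<alpha> \<otimes> cprod x \<beta> k"
    using center_commute [OF c' g] by simp
  finally show ?case using g c by (simp add: m_assoc)
qed

lemma cprod_zero: "(\<And>i. i < k \<Longrightarrow> x i \<in> carrier G) \<Longrightarrow> cprod x (\<lambda>i j. 0) k = \<one>"
  using cprod_add [of k x "\<lambda>i j. 0" "\<lambda>i j. 0"] by (simp add: r_cancel_one')

lemma cprod_uminus:
  assumes "\<And>i. i < k \<Longrightarrow> x i \<in> carrier G"
  shows "cprod x (\<lambda>i j. - \<alpha> i j) k = inv (cprod x \<alpha> k)"
  using cprod_add [of k x "\<lambda>i j. - \<alpha> i j" \<alpha>] assms
  by (simp add: cprod_zero inv_equality)

lemma cprod_scale:
  assumes x: "\<And>i. i < k \<Longrightarrow> x i \<in> carrier G"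
  shows "cprod x (\<lambda>i j. c * \<alpha> i j) k = cprod x \<alpha> k [^] c"
proof -
  have nat: "cprod x (\<lambda>i j. int n * \<alpha> i j) k = cprod x \<alpha> k [^] int n" for n
  proof (induction n)
    case 0 then show ?case using x by (simp add: cprod_zero)
  next
    case (Suc n)
    have "cprod x (\<lambda>i j. int (Suc n) * \<alpha> i j) k = cprod x (\<lambda>i j. int n * \<alpha> i j + \<alpha> i j) k"
      by (simp add: algebra_simps)
    also have "\<dots> = cprod x \<alpha> k [^] int (Suc n)"
      using x Suc by (simp add: cprod_add int_pow_int del: of_nat_Suc)
    finally show ?case .
  qed
  show ?thesis
  proof (cases "c \<ge> 0")
    case True
    then show ?thesis using nat [of "nat c"] by simp
  next
    case False
    then have "cprod x (\<lambda>i j. - (int (nat (- c)) * \<alpha> i j)) k = inv (cprod x \<alpha> k [^] int (nat (- c)))"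
      using x by (simp only: cprod_uminus nat)
    then show ?thesis using False x by (simp add: int_pow_neg)
  qed
qed

lemma cprod_cong:
  assumes "\<And>i j. j < i \<Longrightarrow> i < k \<Longrightarrow> comm G (x i) (x j) [^] \<alpha> i j = comm G (x i) (x j) [^] \<beta> i j"
  shows "cprod x \<alpha> k = cprod x \<beta> k"
  using assms
proof (induction k)
  case (Suc k)
  then have "gprod G (\<lambda>j. comm G (x k) (x j)) (\<alpha> k) k = gprod G (\<lambda>j. comm G (x k) (x j)) (\<beta> k) k"
    by (intro gprod_cong) auto
  then show ?case using Suc by simp
qed simp

text \<open>Collection: moving the power of \<open>x k\<close> from the first product past the
  powers of \<open>x j\<close> with \<open>j < k\<close> in the second costs
  \<open>comm G (x k) (x j)\<close> to the power \<open>a k * b j\<close>. This matches the cross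
  term in degree two of the tensor product.\<close>

lemma gprod_mult:
  assumes x: "\<And>i. i < k \<Longrightarrow> x i \<in> carrier G"
  shows "gprod G x a k \<otimes> gprod G x b k = gprod G x (\<lambda>i. a i + b i) k \<otimes> cprod x (\<lambda>i j. a i * b j) k"
  using assms
proof (induction k)
  case 0 then show ?case by simp
next
  case (Suc k)
  let ?A = "gprod G x a k" and ?B = "gprod G x b k" and ?C = "cprod x (\<lambda>i j. a i * b j) k"
  let ?g = "gprod G (\<lambda>j. comm G (x k) (x j)) (\<lambda>j. a k * b j) k"
  have xk: "x k \<in> carrier G" and xi: "\<And>i. i < k \<Longrightarrow> x i \<in> carrier G" using Suc.prems by auto
  have cl: "?A \<in> carrier G" "?B \<in> carrier G" "?C \<in> carrier G" "?g \<in> carrier G" using xk xi by auto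
  have gz: "?g \<in> center G" using xk xi by (intro gprod_in_subgroup center_subgroup comm_center)
  have Cz: "?C \<in> center G" using xi by (rule cprod_center)
  interpret h: group_hom G G "comm G (x k [^] a k)" using xk by (intro comm_hom_right) simp
  have "comm G (x k [^] a k) ?B = gprod G (\<lambda>j. comm G (x k [^] a k) (x j)) b k"
    using xi by (rule h.hom_gprod)
  also have "\<dots> = ?g"
  proof (rule gprod_cong)
    fix j assume j: "j < k"
    interpret h': group_hom G G "\<lambda>y. comm G y (x j)" using xi [OF j] by (rule comm_hom_left)
    show "comm G (x k [^] a k) (x j) [^] b j = comm G (x k) (x j) [^] (a k * b j)"
      using xk xi [OF j] by (simp add: h'.hom_int_pow int_pow_pow)
  qed
  finally have "x k [^] a k \<otimes> ?B = ?g \<otimes> (?B \<otimes> x k [^] a k)"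
    using comm_swap [of "x k [^] a k" ?B] xk cl by simp
  moreover have "gprod G x a (Suc k) \<otimes> gprod G x b (Suc k) = ?A \<otimes> (x k [^] a k \<otimes> ?B) \<otimes> x k [^] b k"
    using xk cl by (simp add: m_assoc)
  ultimately have "gprod G x a (Suc k) \<otimes> gprod G x b (Suc k) = (?A \<otimes> ?g) \<otimes> ?B \<otimes> x k [^] (a k + b k)"
    using xk cl by (simp add: m_assoc int_pow_mult)
  also have "?A \<otimes> ?g = ?g \<otimes> ?A" using center_commute [OF gz cl(1)] .
  also have "?g \<otimes> ?A \<otimes> ?B = ?g \<otimes> (gprod G x (\<lambda>i. a i + b i) k \<otimes> ?C)"
    using cl xi Suc.IH by (simp add: m_assoc)
  also have "\<dots> \<otimes> x k [^] (a k + b k) = gprod G x (\<lambda>i. a i + b i) k \<otimes> x k [^] (a k + b k) \<otimes> (?C \<otimes> ?g)"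
  proof -
    let ?D = "gprod G x (\<lambda>i. a i + b i) k" and ?y = "x k [^] (a k + b k)"
    have D: "?D \<in> carrier G" "?y \<in> carrier G" using xk xi by auto
    have "?g \<otimes> (?D \<otimes> ?C) \<otimes> ?y = ?g \<otimes> (?D \<otimes> (?C \<otimes> ?y))" using D cl by (simp add: m_assoc)
    also have "?C \<otimes> ?y = ?y \<otimes> ?C" using center_commute [OF Cz D(2)] by simp
    also have "?g \<otimes> (?D \<otimes> (?y \<otimes> ?C)) = ?g \<otimes> (?D \<otimes> ?y \<otimes> ?C)" using D cl by (simp add: m_assoc)
    also have "\<dots> = ?D \<otimes> ?y \<otimes> ?C \<otimes> ?g" using center_commute [OF gz, of "?D \<otimes> ?y \<otimes> ?C"] D cl by simp
    finally show ?thesis using D cl by (simp add: m_assoc)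
  qed
  finally show ?case by simp
qed

end

section \<open>A group on the truncated tensor algebra\<close>

text \<open>By \<open>crit\<close>, the elements of \<open>M\<close> that become central modulo
  \<open>N\<close> form the kernel of \<open>\<pi>\<close>. So for \<open>L = M Mod N\<close> the
  central quotient is \<open>M\<close> modulo that kernel, which is \<open>G\<close>.\<close>

lemma capable_criterion:
  fixes G :: "('a, 'b) monoid_scheme" and M :: "('c, 'd) monoid_scheme"
  assumes G: "group G" and M: "group M" and \<pi>: "\<pi> \<in> hom M G"
    and surj: "\<pi> ` carrier M = carrier G" and N: "N \<lhd> M"
    and crit: "\<And>y. y \<in> carrier M \<Longrightarrow>
      \<pi> y = \<one>\<^bsub>G\<^esub> \<longleftrightarrow> (\<forall>z\<in>carrier M. \<exists>\<nu>\<in>N. y \<otimes>\<^bsub>M\<^esub> z = \<nu> \<otimes>\<^bsub>M\<^esub> (z \<otimes>\<^bsub>M\<^esub> y))"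
  shows "capable G"
proof -
  interpret M: group M by (rule M)
  interpret N: normal N M by (rule N)
  define L where "L = M Mod N"
  have L: "group L" unfolding L_def by (rule N.factorgroup_is_group)
  interpret L: group L by (rule L)
  interpret Z: normal "center L" L by (rule L.center_normal)
  let ?q = "\<lambda>y. N #>\<^bsub>M\<^esub> y"
  let ?\<theta> = "\<lambda>y. center L #>\<^bsub>L\<^esub> (N #>\<^bsub>M\<^esub> y)"
  have q: "?q \<in> hom M L" unfolding L_def by (rule N.r_coset_hom_Mod)
  have cL: "carrier L = ?q ` carrier M" unfolding L_def carrier_FactGroup by blast
  have q_eq: "?q u = ?q v \<longleftrightarrow> (\<exists>\<nu>\<in>N. u = \<nu> \<otimes>\<^bsub>M\<^esub> v)" if "u \<in> carrier M" "v \<in> carrier M" for u v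
  proof
    assume "?q u = ?q v"
    then have "u \<in> ?q v" using M.rcos_self [OF that(1) N.subgroup_axioms] by simp
    then show "\<exists>\<nu>\<in>N. u = \<nu> \<otimes>\<^bsub>M\<^esub> v" by (auto simp: r_coset_def)
  next
    assume "\<exists>\<nu>\<in>N. u = \<nu> \<otimes>\<^bsub>M\<^esub> v"
    then have "u \<in> ?q v" by (auto simp: r_coset_def)
    then show "?q u = ?q v" using M.repr_independence [OF _ that(2) N.subgroup_axioms] by simp
  qed
  have central: "?q y \<in> center L \<longleftrightarrow> \<pi> y = \<one>\<^bsub>G\<^esub>" if y: "y \<in> carrier M" for y
  proof -
    have "?q y \<in> center L \<longleftrightarrow> (\<forall>z\<in>carrier M. ?q y \<otimes>\<^bsub>L\<^esub> ?q z = ?q z \<otimes>\<^bsub>L\<^esub> ?q y)"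
      unfolding center_def cL using y by blast
    also have "\<dots> \<longleftrightarrow> (\<forall>z\<in>carrier M. ?q (y \<otimes>\<^bsub>M\<^esub> z) = ?q (z \<otimes>\<^bsub>M\<^esub> y))"
      using hom_mult [OF q] y by (metis (no_types, lifting))
    also have "\<dots> \<longleftrightarrow> \<pi> y = \<one>\<^bsub>G\<^esub>"
      unfolding crit [OF y] using q_eq y by simp
    finally show ?thesis .
  qed
  have \<theta>: "?\<theta> \<in> hom M (L Mod center L)"
    using hom_compose [OF q Z.r_coset_hom_Mod] by (simp add: comp_def)
  interpret \<pi>: group_hom M G \<pi> using G \<pi> by (intro group_hom.intro M group_hom_axioms.intro)
  interpret \<theta>: group_hom M "L Mod center L" ?\<theta>
    using \<theta> by (intro group_hom.intro M Z.factorgroup_is_group group_hom_axioms.intro)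
  have \<theta>_surj: "?\<theta> ` carrier M = carrier (L Mod center L)"
    unfolding carrier_FactGroup cL by blast
  have "center L #>\<^bsub>L\<^esub> l = center L \<longleftrightarrow> l \<in> center L" if "l \<in> carrier L" for l
    using L.rcos_self [OF that Z.subgroup_axioms] L.coset_join2 [OF that Z.subgroup_axioms] by metis
  then have "kernel M (L Mod center L) ?\<theta> = kernel M G \<pi>"
    using central by (auto simp: kernel_def cL)
  then have "M Mod kernel M G \<pi> \<cong> L Mod center L" using \<theta>.FactGroup_iso [OF \<theta>_surj] by simp
  moreover have "G \<cong> M Mod kernel M G \<pi>"
    using group.iso_sym [OF normal.factorgroup_is_group [OF \<pi>.normal_kernel] \<pi>.FactGroup_iso [OF surj]] .
  ultimately have "G \<cong> L Mod center L" by (blast intro: iso_trans)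
  then show ?thesis by (rule capableI [OF G L])
qed

section \<open>Units of the truncated tensor algebra\<close>

type_synonym tensor = "(nat \<Rightarrow> int) \<times> (nat \<Rightarrow> nat \<Rightarrow> int) \<times> (nat \<Rightarrow> nat \<Rightarrow> nat \<Rightarrow> int)"

text \<open>The triple \<open>(a, \<alpha>, t)\<close> stands for \<open>1 + a + \<alpha> + t\<close> in the tensor algebra truncated above
  degree three.  The condition on the symmetric part of \<open>\<alpha>\<close> makes the quotient by degree three
  the relatively free group of class two and exponent \<open>p\<close>, once coefficients are read modulo \<open>p\<close>.\<close>

definition tensor_group :: "int \<Rightarrow> nat \<Rightarrow> tensor monoid" where
  "tensor_group p n =
     \<lparr>carrier = {(a, \<alpha>, t). \<forall>i<n. \<forall>j<n. p dvd \<alpha> i j + \<alpha> j i - a i * a j},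
      monoid.mult = (\<lambda>(a, \<alpha>, t) (a', \<alpha>', t').
        (\<lambda>i. a i + a' i, \<lambda>i j. \<alpha> i j + \<alpha>' i j + a i * a' j,
         \<lambda>i j l. t i j l + t' i j l + a i * \<alpha>' j l + \<alpha> i j * a' l)),
      one = (\<lambda>i. 0, \<lambda>i j. 0, \<lambda>i j l. 0)\<rparr>"

lemma tensor_mult:
  "(a, \<alpha>, t) \<otimes>\<^bsub>tensor_group p n\<^esub> (a', \<alpha>', t') =
    (\<lambda>i. a i + a' i, \<lambda>i j. \<alpha> i j + \<alpha>' i j + a i * a' j,
     \<lambda>i j l. t i j l + t' i j l + a i * \<alpha>' j l + \<alpha> i j * a' l)"
  by (simp add: tensor_group_def)

lemma tensor_carrier:
  "(a, \<alpha>, t) \<in> carrier (tensor_group p n) \<longleftrightarrow>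
    (\<forall>i<n. \<forall>j<n. p dvd \<alpha> i j + \<alpha> j i - a i * a j)"
  by (simp add: tensor_group_def)

lemma tensor_one: "\<one>\<^bsub>tensor_group p n\<^esub> = (\<lambda>i. 0, \<lambda>i j. 0, \<lambda>i j l. 0)"
  by (simp add: tensor_group_def)

lemma group_tensor_group: "group (tensor_group p n)"
proof (rule groupI)
  fix u v assume "u \<in> carrier (tensor_group p n)" "v \<in> carrier (tensor_group p n)"
  then obtain a \<alpha> t a' \<alpha>' t' where u: "u = (a, \<alpha>, t)" and v: "v = (a', \<alpha>', t')"
    and d: "\<And>i j. i < n \<Longrightarrow> j < n \<Longrightarrow> p dvd \<alpha> i j + \<alpha> j i - a i * a j"
      "\<And>i j. i < n \<Longrightarrow> j < n \<Longrightarrow> p dvd \<alpha>' i j + \<alpha>' j i - a' i * a' j"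
    by (cases u, cases v) (auto simp: tensor_carrier)
  show "u \<otimes>\<^bsub>tensor_group p n\<^esub> v \<in> carrier (tensor_group p n)"
    unfolding u v tensor_mult tensor_carrier
  proof (intro allI impI)
    fix i j assume "i < n" "j < n"
    then have "p dvd (\<alpha> i j + \<alpha> j i - a i * a j) + (\<alpha>' i j + \<alpha>' j i - a' i * a' j)"
      using d by (intro dvd_add)
    then show "p dvd \<alpha> i j + \<alpha>' i j + a i * a' j + (\<alpha> j i + \<alpha>' j i + a j * a' i)
        - (a i + a' i) * (a j + a' j)"
      by (simp add: algebra_simps)
  qed
next
  show "\<one>\<^bsub>tensor_group p n\<^esub> \<in> carrier (tensor_group p n)"
    by (simp add: tensor_one tensor_carrier)
next
  fix u v w :: tensor
  show "u \<otimes>\<^bsub>tensor_group p n\<^esub> v \<otimes>\<^bsub>tensor_group p n\<^esub> w = u \<otimes>\<^bsub>tensor_group p n\<^esub> (v \<otimes>\<^bsub>tensor_group p n\<^esub> w)"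
    by (cases u, cases v, cases w) (simp add: tensor_mult algebra_simps)
next
  fix u :: tensor
  show "\<one>\<^bsub>tensor_group p n\<^esub> \<otimes>\<^bsub>tensor_group p n\<^esub> u = u"
    by (cases u) (simp add: tensor_mult tensor_one)
next
  fix u assume u: "u \<in> carrier (tensor_group p n)"
  obtain a \<alpha> t where eq: "u = (a, \<alpha>, t)" by (cases u)
  \<comment> \<open>The left inverse of \<open>1 + a + \<alpha> + t\<close>, solved degree by
    degree.\<close>
  define v where "v = (\<lambda>i. - a i, \<lambda>i j. a i * a j - \<alpha> i j,
    \<lambda>i j l. a i * \<alpha> j l - (a i * a j - \<alpha> i j) * a l - t i j l)"
  have "v \<in> carrier (tensor_group p n)"
    unfolding v_def tensor_carrier
  proof (intro allI impI)
    fix i j assume "i < n" "j < n"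
    then have "p dvd - (\<alpha> i j + \<alpha> j i - a i * a j)" using u unfolding eq tensor_carrier dvd_minus_iff by blast
    then show "p dvd a i * a j - \<alpha> i j + (a j * a i - \<alpha> j i) - - a i * - a j" by (simp add: algebra_simps)
  qed
  moreover have "v \<otimes>\<^bsub>tensor_group p n\<^esub> u = \<one>\<^bsub>tensor_group p n\<^esub>"
    by (simp add: v_def eq tensor_mult tensor_one)
  ultimately show "\<exists>v\<in>carrier (tensor_group p n). v \<otimes>\<^bsub>tensor_group p n\<^esub> u = \<one>\<^bsub>tensor_group p n\<^esub>" by blast
qed

section \<open>Dividing degree three by brackets with the space of forms\<close>

context alternating_forms
begin

text \<open>Modulo \<open>p\<close>, \<open>t\<close> is the sum of the commutators of \<open>\<xi> l\<close> with the basis vector \<open>e\<^sub>l\<close>: the right-hand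
  side is the coefficient of \<open>e\<^sub>i \<otimes> e\<^sub>j \<otimes> e\<^sub>l\<close> in \<open>\<Sum>l. \<xi> l \<otimes> e\<^sub>l - e\<^sub>l \<otimes> \<xi> l\<close>.\<close>

definition brackets :: "(nat \<Rightarrow> nat \<Rightarrow> nat \<Rightarrow> int) set" where
  "brackets = {t. \<exists>\<xi>. (\<forall>l. \<xi> l \<in> R) \<and>
     (\<forall>i<n. \<forall>j<n. \<forall>l<n. p dvd t i j l - (\<xi> l i j - \<xi> i j l))}"

lemma brackets_lin:
  assumes "s \<in> brackets" "t \<in> brackets"
    and c: "\<And>i j l. i < n \<Longrightarrow> j < n \<Longrightarrow> l < n \<Longrightarrow> p dvd u i j l - (s i j l + c * t i j l)"
  shows "u \<in> brackets"
proof -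
  obtain \<xi> where \<xi>R: "\<forall>l. \<xi> l \<in> R"
    and \<xi>: "\<forall>i<n. \<forall>j<n. \<forall>l<n. p dvd s i j l - (\<xi> l i j - \<xi> i j l)"
    using assms(1) unfolding brackets_def by (elim CollectE exE conjE)
  obtain \<zeta> where \<zeta>R: "\<forall>l. \<zeta> l \<in> R"
    and \<zeta>: "\<forall>i<n. \<forall>j<n. \<forall>l<n. p dvd t i j l - (\<zeta> l i j - \<zeta> i j l)"
    using assms(2) unfolding brackets_def by (elim CollectE exE conjE)
  define \<eta> where "\<eta> l = (\<lambda>i j. \<xi> l i j + c * \<zeta> l i j)" for l
  have "p dvd u i j l - (\<eta> l i j - \<eta> i j l)" if ijl: "i < n" "j < n" "l < n" for i j l
  proof -
    have "p dvd (u i j l - (s i j l + c * t i j l)) + (s i j l - (\<xi> l i j - \<xi> i j l)) +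
        c * (t i j l - (\<zeta> l i j - \<zeta> i j l))"
      using \<xi> \<zeta> c ijl by (intro dvd_add dvd_mult) blast+
    then show ?thesis by (simp add: \<eta>_def algebra_simps)
  qed
  moreover have "\<eta> l \<in> R" for l unfolding \<eta>_def using \<xi>R \<zeta>R by (intro R_lin) blast+
  ultimately show ?thesis unfolding brackets_def by (intro CollectI exI [of _ \<eta>]) blast
qed

lemma brackets_zero: "(\<lambda>i j l. 0) \<in> brackets"
  unfolding brackets_def using R_zero by (auto intro!: exI [of _ "\<lambda>l i j. 0"])

lemma brackets_cong:
  assumes "t \<in> brackets" and "\<And>i j l. i < n \<Longrightarrow> j < n \<Longrightarrow> l < n \<Longrightarrow> p dvd u i j l - t i j l"
  shows "u \<in> brackets"
  using assms by (intro brackets_lin [OF assms(1) brackets_zero, of u 0]) simp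

abbreviation K where "K \<equiv> tensor_group p n"

text \<open>The subgroup to divide out: it reduces degrees one and two modulo \<open>p\<close> and
  replaces degree three by its quotient by \<open>brackets\<close>.\<close>

definition rels :: "tensor set" where
  "rels = {(a, \<alpha>, t). (\<forall>i<n. p dvd a i) \<and> (\<forall>i<n. \<forall>j<n. p dvd \<alpha> i j) \<and> t \<in> brackets}"

lemma mem_rels: "(a, \<alpha>, t) \<in> rels \<longleftrightarrow>
    (\<forall>i<n. p dvd a i) \<and> (\<forall>i<n. \<forall>j<n. p dvd \<alpha> i j) \<and> t \<in> brackets"
  by (simp add: rels_def)

lemma rels_subset: "rels \<subseteq> carrier K"
  by (auto simp: rels_def tensor_carrier intro!: dvd_diff dvd_add)

text \<open>Cosets can be compared degree by degree: the cross terms produced by multiplication with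
  a member of \<open>rels\<close> are multiples of \<open>p\<close>, which \<open>brackets\<close>
  absorbs.\<close>

lemma rels_coset:
  "(\<exists>\<nu>\<in>rels. (a, \<alpha>, t) = \<nu> \<otimes>\<^bsub>K\<^esub> (a', \<alpha>', t')) \<longleftrightarrow>
    (\<forall>i<n. p dvd a i - a' i) \<and> (\<forall>i<n. \<forall>j<n. p dvd \<alpha> i j - \<alpha>' i j) \<and>
    (\<lambda>i j l. t i j l - t' i j l) \<in> brackets" (is "?L \<longleftrightarrow> ?R")
proof
  assume ?L
  then obtain d \<delta> \<tau> where \<nu>: "(d, \<delta>, \<tau>) \<in> rels" and eq: "(a, \<alpha>, t) = (d, \<delta>, \<tau>) \<otimes>\<^bsub>K\<^esub> (a', \<alpha>', t')"
    by (metis prod_cases3)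
  then have "a = (\<lambda>i. d i + a' i)" "\<alpha> = (\<lambda>i j. \<delta> i j + \<alpha>' i j + d i * a' j)"
    "t = (\<lambda>i j l. \<tau> i j l + t' i j l + d i * \<alpha>' j l + \<delta> i j * a' l)"
    by (simp_all add: tensor_mult)
  moreover have "(\<lambda>i j l. \<tau> i j l + d i * \<alpha>' j l + \<delta> i j * a' l) \<in> brackets"
  proof (rule brackets_cong [of \<tau>])
    fix i j l assume "i < n" "j < n" "l < n"
    then have "p dvd d i * \<alpha>' j l + \<delta> i j * a' l" using \<nu> by (simp add: mem_rels)
    then show "p dvd \<tau> i j l + d i * \<alpha>' j l + \<delta> i j * a' l - \<tau> i j l" by (simp add: algebra_simps)
  qed (use \<nu> in \<open>simp add: mem_rels\<close>)
  ultimately show ?R using \<nu> by (simp add: mem_rels algebra_simps)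
next
  assume R: ?R
  \<comment> \<open>The quotient of the two tensors, again solved degree by degree.\<close>
  define d where "d i = a i - a' i" for i
  define \<delta> where "\<delta> i j = \<alpha> i j - \<alpha>' i j - d i * a' j" for i j
  define \<tau> where "\<tau> i j l = t i j l - t' i j l - d i * \<alpha>' j l - \<delta> i j * a' l" for i j l
  have d: "p dvd d i" if "i < n" for i using R that by (simp add: d_def)
  have \<delta>: "p dvd \<delta> i j" if "i < n" "j < n" for i j using R d that by (simp add: \<delta>_def)
  have \<tau>: "p dvd \<tau> i j l - (t i j l - t' i j l)" if "i < n" "j < n" "l < n" for i j l
  proof -
    have "p dvd - (d i * \<alpha>' j l + \<delta> i j * a' l)" using d \<delta> that by simp
    then show ?thesis by (simp add: \<tau>_def algebra_simps)
  qed
  have "(\<lambda>i j l. t i j l - t' i j l) \<in> brackets" using R by blast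
  then have "\<tau> \<in> brackets" by (rule brackets_cong) (rule \<tau>)
  then have "(d, \<delta>, \<tau>) \<in> rels" using d \<delta> by (simp add: mem_rels)
  moreover have "(a, \<alpha>, t) = (d, \<delta>, \<tau>) \<otimes>\<^bsub>K\<^esub> (a', \<alpha>', t')"
    by (simp add: tensor_mult d_def \<delta>_def \<tau>_def)
  ultimately show ?L by blast
qed

text \<open>Modulo \<open>p\<close> a member of \<open>rels\<close> lives in degree three, where
  truncation kills its products with degree one and above. Inverses and conjugates are then read off
  through \<open>rels_coset\<close>.\<close>

lemma rels_normal: "rels \<lhd> K"
proof -
  interpret K: group K by (rule group_tensor_group)
  have "subgroup rels K"
  proof (rule K.subgroupI)
    show "rels \<subseteq> carrier K" by (rule rels_subset)
    have "\<one>\<^bsub>K\<^esub> \<in> rels" by (simp add: tensor_one mem_rels brackets_zero)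
    then show "rels \<noteq> {}" by blast
  next
    fix u assume u: "u \<in> rels"
    obtain a \<alpha> t where eq: "u = (a, \<alpha>, t)" by (cases u)
    have "(\<lambda>i j l. - t i j l) \<in> brackets"
    proof (rule brackets_lin [OF brackets_zero])
      show "t \<in> brackets" using u by (simp add: eq mem_rels)
      show "p dvd - t i j l - (0 + (-1) * t i j l)" for i j l by simp
    qed
    then have "\<exists>\<nu>\<in>rels. \<one>\<^bsub>K\<^esub> = \<nu> \<otimes>\<^bsub>K\<^esub> u"
      unfolding eq tensor_one rels_coset
      using u by (simp add: eq mem_rels)
    then obtain \<nu> where "\<nu> \<in> rels" "\<nu> \<otimes>\<^bsub>K\<^esub> u = \<one>\<^bsub>K\<^esub>" by (elim bexE) simp
    moreover from this have "inv\<^bsub>K\<^esub> u = \<nu>" using rels_subset u by (intro K.inv_equality) blast+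
    ultimately show "inv\<^bsub>K\<^esub> u \<in> rels" by simp
  next
    fix u v assume u: "u \<in> rels" and v: "v \<in> rels"
    obtain a \<alpha> t a' \<alpha>' t' where eq: "u = (a, \<alpha>, t)" "v = (a', \<alpha>', t')" by (cases u, cases v)
    have "(\<lambda>i j l. t i j l + t' i j l + a i * \<alpha>' j l + \<alpha> i j * a' l) \<in> brackets"
    proof (rule brackets_lin [of t t' _ 1])
      fix i j l assume "i < n" "j < n" "l < n"
      then have "p dvd a i * \<alpha>' j l + \<alpha> i j * a' l" using u by (simp add: eq mem_rels)
      then show "p dvd t i j l + t' i j l + a i * \<alpha>' j l + \<alpha> i j * a' l - (t i j l + 1 * t' i j l)"
        by (simp add: algebra_simps)
    qed (use u v in \<open>auto simp: eq mem_rels\<close>)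
    then show "u \<otimes>\<^bsub>K\<^esub> v \<in> rels" using u v by (simp add: eq tensor_mult mem_rels)
  qed
  then show ?thesis
  proof (rule K.normal_invI)
    fix u v assume u: "u \<in> carrier K" and v: "v \<in> rels"
    have vK: "v \<in> carrier K" using v rels_subset by blast
    obtain a \<alpha> t d \<delta> \<tau> where eq: "u = (a, \<alpha>, t)" "v = (d, \<delta>, \<tau>)" by (cases u, cases v)
    have "\<exists>\<nu>\<in>rels. u \<otimes>\<^bsub>K\<^esub> v = \<nu> \<otimes>\<^bsub>K\<^esub> u"
      unfolding eq tensor_mult rels_coset
    proof (intro conjI allI impI)
      fix i j assume "i < n" "j < n"
      then show "p dvd \<alpha> i j + \<delta> i j + a i * d j - \<alpha> i j" using v by (simp add: eq mem_rels)
    next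
      fix i assume "i < n" then show "p dvd a i + d i - a i" using v by (simp add: eq mem_rels)
    next
      show "(\<lambda>i j l. t i j l + \<tau> i j l + a i * \<delta> j l + \<alpha> i j * d l - t i j l) \<in> brackets"
      proof (rule brackets_cong [of \<tau>])
        fix i j l assume "i < n" "j < n" "l < n"
        then have "p dvd a i * \<delta> j l + \<alpha> i j * d l" using v by (simp add: eq mem_rels)
        then show "p dvd t i j l + \<tau> i j l + a i * \<delta> j l + \<alpha> i j * d l - t i j l - \<tau> i j l"
          by (simp add: algebra_simps)
      qed (use v in \<open>simp add: eq mem_rels\<close>)
    qed
    then obtain \<nu> where \<nu>: "\<nu> \<in> rels" "u \<otimes>\<^bsub>K\<^esub> v = \<nu> \<otimes>\<^bsub>K\<^esub> u" by blast
    have "\<nu> \<in> carrier K" using \<nu>(1) rels_subset by blast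
    then have "u \<otimes>\<^bsub>K\<^esub> v \<otimes>\<^bsub>K\<^esub> inv\<^bsub>K\<^esub> u = \<nu>"
      unfolding \<nu>(2) using u by (simp add: K.m_assoc)
    then show "u \<otimes>\<^bsub>K\<^esub> v \<otimes>\<^bsub>K\<^esub> inv\<^bsub>K\<^esub> u \<in> rels" using \<nu>(1) by simp
  qed
qed

text \<open>The premise \<open>closed\<close> says that \<open>\<alpha>\<close> lies in
  \<open>R\<close> once its brackets with all basis vectors lie in \<open>brackets\<close>.
  Commuting with lifted basis vectors yields \<open>a\<close> in degree two and these brackets in
  degree three.\<close>

lemma central_mod_rels_iff:
  assumes n: "n > 1" and y: "(a, \<alpha>, t) \<in> carrier K"
    and closed: "(\<And>i j. i < n \<Longrightarrow> j < n \<Longrightarrow> p dvd \<alpha> i j + \<alpha> j i) \<Longrightarrow>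
      (\<And>k. k < n \<Longrightarrow> \<exists>\<xi>. (\<forall>l. \<xi> l \<in> R) \<and> (\<forall>i<n. \<forall>j<n. \<forall>l<n.
        p dvd (\<alpha> i j * of_bool (l = k) - of_bool (i = k) * \<alpha> j l) - (\<xi> l i j - \<xi> i j l))) \<Longrightarrow> \<alpha> \<in> R"
  shows "(\<forall>z\<in>carrier K. \<exists>\<nu>\<in>rels. (a, \<alpha>, t) \<otimes>\<^bsub>K\<^esub> z = \<nu> \<otimes>\<^bsub>K\<^esub> (z \<otimes>\<^bsub>K\<^esub> (a, \<alpha>, t))) \<longleftrightarrow>
    (\<forall>i<n. p dvd a i) \<and> \<alpha> \<in> R" (is "?L \<longleftrightarrow> ?R")
proof
  assume R: ?R
  show ?L
  proof
    fix z assume z: "z \<in> carrier K"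
    obtain b \<beta> s where eq: "z = (b, \<beta>, s)" by (cases z)
    show "\<exists>\<nu>\<in>rels. (a, \<alpha>, t) \<otimes>\<^bsub>K\<^esub> z = \<nu> \<otimes>\<^bsub>K\<^esub> (z \<otimes>\<^bsub>K\<^esub> (a, \<alpha>, t))"
      unfolding eq tensor_mult rels_coset
    proof (intro conjI allI impI)
      fix i j assume "i < n" "j < n"
      then have "p dvd a i * b j - b i * a j" using R by simp
      then show "p dvd \<alpha> i j + \<beta> i j + a i * b j - (\<beta> i j + \<alpha> i j + b i * a j)" by (simp add: algebra_simps)
    next
      have "p dvd (t i j l + s i j l + a i * \<beta> j l + \<alpha> i j * b l - (s i j l + t i j l + b i * \<alpha> j l + \<beta> i j * a l))
          - (b l * \<alpha> i j - b i * \<alpha> j l)" if "i < n" "j < n" "l < n" for i j l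
      proof -
        have "p dvd a i * \<beta> j l - \<beta> i j * a l" using R that by simp
        then show ?thesis by (simp add: algebra_simps)
      qed
      \<comment> \<open>The bracket of \<open>\<alpha>\<close> with \<open>b\<close> is the sum over
        \<open>l\<close> of the brackets of \<open>b l * \<alpha>\<close> with the basis
        vectors.\<close>
      moreover have "\<forall>l. (\<lambda>i j. b l * \<alpha> i j) \<in> R" using R R_scale by blast
      ultimately show "(\<lambda>i j l. t i j l + s i j l + a i * \<beta> j l + \<alpha> i j * b l -
          (s i j l + t i j l + b i * \<alpha> j l + \<beta> i j * a l)) \<in> brackets"
        unfolding brackets_def by (intro CollectI exI [of _ "\<lambda>l i j. b l * \<alpha> i j"]) blast
    qed simp
  qed
next
  assume L: ?L
  define e where "e k = ((\<lambda>i. of_bool (i = k)) :: nat \<Rightarrow> int)" for k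
  \<comment> \<open>\<open>(p + 1) div 2\<close> is one half modulo \<open>p\<close>; this diagonal
    entry gives \<open>e k\<close> the symmetric part that the carrier requires.\<close>
  define \<epsilon> where "\<epsilon> k = (\<lambda>i j. of_bool (i = k \<and> j = k) * ((p + 1) div 2))" for k :: nat
  have two: "2 * ((p + 1) div 2) = p + 1" using odd_p by (intro dvd_mult_div_cancel) simp
  have eK: "(e k, \<epsilon> k, \<lambda>i j l. 0) \<in> carrier K" for k
    using two by (auto simp: tensor_carrier e_def \<epsilon>_def)
  have comm: "\<exists>\<nu>\<in>rels. (a, \<alpha>, t) \<otimes>\<^bsub>K\<^esub> (e k, \<epsilon> k, \<lambda>i j l. 0) = \<nu> \<otimes>\<^bsub>K\<^esub> ((e k, \<epsilon> k, \<lambda>i j l. 0) \<otimes>\<^bsub>K\<^esub> (a, \<alpha>, t))" for k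
    using L eK by blast
  have deg2: "p dvd \<alpha> i j + \<epsilon> k i j + a i * e k j - (\<epsilon> k i j + \<alpha> i j + e k i * a j)"
    if "i < n" "j < n" for i j k
    using comm [of k] that unfolding tensor_mult rels_coset by blast
  have deg3: "(\<lambda>i j l. t i j l + 0 + a i * \<epsilon> k j l + \<alpha> i j * e k l - (0 + t i j l + e k i * \<alpha> j l + \<epsilon> k i j * a l)) \<in> brackets" for k
    using comm [of k] unfolding tensor_mult rels_coset by blast
  have a: "p dvd a i" if i: "i < n" for i
  proof -
    \<comment> \<open>Here \<open>n > 1\<close> enters: at position \<open>(i, k)\<close> with
      \<open>k \<noteq> i\<close>, commuting with the lift of \<open>e k\<close> leaves just
      \<open>a i\<close>.\<close>
    obtain k where k: "k < n" "k \<noteq> i" using n by (metis i less_trans neq0_conv zero_neq_one zero_less_one)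
    then show ?thesis using deg2 [OF i k(1), of k] by (simp add: e_def)
  qed
  have "\<alpha> \<in> R"
  proof (rule closed)
    fix i j assume ij: "i < n" "j < n"
    then have "p dvd \<alpha> i j + \<alpha> j i - a i * a j" using y by (simp add: tensor_carrier)
    moreover have "p dvd a i * a j" using a ij by simp
    ultimately show "p dvd \<alpha> i j + \<alpha> j i" by (metis diff_add_cancel dvd_add)
  next
    fix k assume k: "k < n"
    obtain \<xi> where \<xi>: "\<forall>l. \<xi> l \<in> R" "\<And>i j l. i < n \<Longrightarrow> j < n \<Longrightarrow> l < n \<Longrightarrow>
      p dvd t i j l + 0 + a i * \<epsilon> k j l + \<alpha> i j * e k l - (0 + t i j l + e k i * \<alpha> j l + \<epsilon> k i j * a l)
        - (\<xi> l i j - \<xi> i j l)"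
      using deg3 [of k] unfolding brackets_def by blast
    have "p dvd \<alpha> i j * of_bool (l = k) - of_bool (i = k) * \<alpha> j l - (\<xi> l i j - \<xi> i j l)"
      if ijl: "i < n" "j < n" "l < n" for i j l
    proof -
      have "p dvd (t i j l + 0 + a i * \<epsilon> k j l + \<alpha> i j * e k l - (0 + t i j l + e k i * \<alpha> j l + \<epsilon> k i j * a l)
        - (\<xi> l i j - \<xi> i j l)) - (a i * \<epsilon> k j l - \<epsilon> k i j * a l)"
        using a ijl by (intro dvd_diff [OF \<xi>(2)]) auto
      then show ?thesis by (simp add: e_def algebra_simps)
    qed
    then show "\<exists>\<xi>. (\<forall>l. \<xi> l \<in> R) \<and> (\<forall>i<n. \<forall>j<n. \<forall>l<n.
        p dvd (\<alpha> i j * of_bool (l = k) - of_bool (i = k) * \<alpha> j l) - (\<xi> l i j - \<xi> i j l))"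
      using \<xi>(1) by blast
  qed
  then show ?R using a by blast
qed

end

section \<open>Capability\<close>

lemma (in group) gprod_zero: "gprod G x (\<lambda>i. 0) k = \<one>"
  by (induction k) simp_all

lemma (in comm_group) center_eq_carrier: "center G = carrier G"
  by (auto simp: center_def m_comm)

text \<open>Exponent vectors with entries in \<open>{0..<p}\<close> give distinct products, since
  the quotient of equal products has exponents divisible by \<open>p\<close>.\<close>

lemma has_rank_card_ge:
  assumes p: "Factorial_Ring.prime p" and A: "comm_group A"
    and ex: "\<And>x. x \<in> carrier A \<Longrightarrow> x [^]\<^bsub>A\<^esub> p = \<one>\<^bsub>A\<^esub>" and rank: "has_rank p A r"
    and fin: "finite (carrier A)"
  shows "p ^ r \<le> card (carrier A)"
proof -
  interpret A: comm_group A by (rule A)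
  obtain b where b: "\<And>i. i < r \<Longrightarrow> b i \<in> carrier A"
    and indep: "\<And>c i. gprod A b c r = \<one>\<^bsub>A\<^esub> \<Longrightarrow> i < r \<Longrightarrow> int p dvd c i"
    using has_rank_basis [OF p A ex rank] by metis
  have "card ({..<r} \<rightarrow>\<^sub>E {0..<int p}) \<le> card (carrier A)"
  proof (rule card_inj_on_le [OF _ _ fin])
    show "(\<lambda>c. gprod A b c r) ` ({..<r} \<rightarrow>\<^sub>E {0..<int p}) \<subseteq> carrier A" using b by auto
    show "inj_on (\<lambda>c. gprod A b c r) ({..<r} \<rightarrow>\<^sub>E {0..<int p})"
    proof (rule inj_onI)
      fix c c' assume c: "c \<in> {..<r} \<rightarrow>\<^sub>E {0..<int p}" and c': "c' \<in> {..<r} \<rightarrow>\<^sub>E {0..<int p}"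
        and eq: "gprod A b c r = gprod A b c' r"
      have "gprod A b (\<lambda>i. (c i - c' i) + c' i) r = gprod A b (\<lambda>i. c i - c' i) r \<otimes>\<^bsub>A\<^esub> gprod A b c' r"
        using b by (intro A.gprod_add) (simp add: A.center_eq_carrier)
      then have "gprod A b (\<lambda>i. c i - c' i) r \<otimes>\<^bsub>A\<^esub> gprod A b c' r = gprod A b c' r" using eq by simp
      then have "gprod A b (\<lambda>i. c i - c' i) r = \<one>\<^bsub>A\<^esub>" using b by (simp add: A.r_cancel_one)
      then have dvd: "int p dvd c i - c' i" if "i < r" for i using indep that by blast
      show "c = c'"
      proof (rule PiE_ext [OF c c'])
        fix i assume i: "i \<in> {..<r}"
        then have "c i \<in> {0..<int p}" "c' i \<in> {0..<int p}" using PiE_mem [OF c] PiE_mem [OF c'] by blast+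
        moreover have "c i mod int p = c' i mod int p" using dvd [of i] i by (simp add: mod_eq_dvd_iff)
        ultimately show "c i = c' i" by simp
      qed
    qed
  qed
  then show ?thesis by (simp add: card_PiE)
qed

lemma (in class2_group) derived_subset_center: "derived G (carrier G) \<subseteq> center G"
  unfolding derived_def
  by (rule generate_subgroup_incl [OF _ center_subgroup]) (use comm_center in \<open>auto simp: comm_def\<close>)

text \<open>The elements \<open>x i\<close> are lifts of a basis of the abelianization:
  \<open>generating\<close> says that their images span, \<open>independent\<close> that they are
  linearly independent.\<close>

locale generated_class2_group = class2_group G for G (structure) +
  fixes p n :: nat and x :: "nat \<Rightarrow> 'a"
  assumes p: "Factorial_Ring.prime p" and odd_p: "odd p" and n: "n > 1"
    and x: "i < n \<Longrightarrow> x i \<in> carrier G"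
    and exponent: "g \<in> carrier G \<Longrightarrow> g [^] int p = \<one>"
    and generating: "g \<in> carrier G \<Longrightarrow> \<exists>a. \<exists>d\<in>derived G (carrier G). g = gprod G x a n \<otimes> d"
    and independent: "gprod G x a n \<in> derived G (carrier G) \<Longrightarrow> i < n \<Longrightarrow> int p dvd a i"
begin

lemma cprod_cong_mod:
  assumes "\<And>i j. j < i \<Longrightarrow> i < n \<Longrightarrow> int p dvd \<alpha> i j - \<beta> i j"
  shows "cprod x \<alpha> n = cprod x \<beta> n"
proof (rule cprod_cong)
  fix i j assume "j < i" "i < n"
  then show "comm G (x i) (x j) [^] \<alpha> i j = comm G (x i) (x j) [^] \<beta> i j"
    using x assms exponent by (intro int_pow_cong_exponent [of _ p]) auto
qed

lemma gprod_eq_one: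
  assumes "\<And>i. i < n \<Longrightarrow> int p dvd a i"
  shows "gprod G x a n = \<one>"
proof -
  have "gprod G x a n = gprod G x (\<lambda>i. 0) n"
    using x assms exponent by (intro gprod_cong int_pow_cong_exponent [of _ p]) auto
  then show ?thesis by (simp add: gprod_zero)
qed

text \<open>Factors from the commutator subgroup are central and drop out. Collecting the two
  ordered products in both orders then leaves the form \<open>a i * b j - b i * a j\<close>.\<close>

lemma comm_eq_cprod:
  assumes "g \<in> carrier G" "h \<in> carrier G"
  shows "\<exists>\<alpha>. comm G g h = cprod x \<alpha> n"
proof -
  obtain a d where d: "d \<in> derived G (carrier G)" and g: "g = gprod G x a n \<otimes> d"
    using generating [OF assms(1)] by blast
  obtain b e where e: "e \<in> derived G (carrier G)" and h: "h = gprod G x b n \<otimes> e"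
    using generating [OF assms(2)] by blast
  have dz: "d \<in> center G" "e \<in> center G" using d e derived_subset_center by auto
  let ?a = "gprod G x a n" and ?b = "gprod G x b n"
  let ?c = "cprod x (\<lambda>i j. a i * b j - b i * a j) n" and ?ba = "cprod x (\<lambda>i j. b i * a j) n"
  let ?ab = "gprod G x (\<lambda>i. a i + b i) n"
  have cl: "?a \<in> carrier G" "?b \<in> carrier G" "d \<in> carrier G" "e \<in> carrier G" "?c \<in> carrier G" "?ba \<in> carrier G" "?ab \<in> carrier G"
    using x dz by (auto intro: center_closed)
  have cz: "comm G z u = \<one>" "comm G u z = \<one>" if "z \<in> center G" "u \<in> carrier G" for z u
    using that center_commute [OF that] by (auto intro!: comm_eqI simp: center_closed)
  have "comm G g h = comm G ?a ?b"
    unfolding g h using cl dz by (simp add: comm_mult_left comm_mult_right cz)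
  also have "\<dots> = ?c"
  proof (rule comm_eqI)
    have "?a \<otimes> ?b = ?ab \<otimes> cprod x (\<lambda>i j. (a i * b j - b i * a j) + b i * a j) n"
      using gprod_mult [of n x a b] x by simp
    also have "\<dots> = ?ab \<otimes> (?c \<otimes> ?ba)" using x by (simp only: cprod_add)
    also have "\<dots> = ?ab \<otimes> ?c \<otimes> ?ba" using cl by (simp add: m_assoc)
    also have "?ab \<otimes> ?c = ?c \<otimes> ?ab" using cl x by (intro center_commute cprod_center)
    also have "?c \<otimes> ?ab \<otimes> ?ba = ?c \<otimes> (?b \<otimes> ?a)"
      using gprod_mult [of n x b a] x cl by (simp add: m_assoc add.commute)
    finally show "?a \<otimes> ?b = ?c \<otimes> (?b \<otimes> ?a)" .
  qed (use cl in auto)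
  finally show ?thesis by blast
qed

lemma derived_eq_cprod: "derived G (carrier G) = range (\<lambda>\<alpha>. cprod x \<alpha> n)"
proof
  have "subgroup (range (\<lambda>\<alpha>. cprod x \<alpha> n)) G"
  proof (rule subgroupI)
    show "range (\<lambda>\<alpha>. cprod x \<alpha> n) \<subseteq> carrier G" using x by auto
    show "range (\<lambda>\<alpha>. cprod x \<alpha> n) \<noteq> {}" by blast
  next
    fix u assume "u \<in> range (\<lambda>\<alpha>. cprod x \<alpha> n)"
    then obtain \<alpha> where u: "u = cprod x \<alpha> n" by blast
    show "inv u \<in> range (\<lambda>\<alpha>. cprod x \<alpha> n)"
      unfolding u by (rule range_eqI, rule cprod_uminus [symmetric]) (rule x)
    fix v assume "v \<in> range (\<lambda>\<alpha>. cprod x \<alpha> n)"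
    then obtain \<beta> where v: "v = cprod x \<beta> n" by blast
    show "u \<otimes> v \<in> range (\<lambda>\<alpha>. cprod x \<alpha> n)"
      unfolding u v by (rule range_eqI, rule cprod_add [symmetric]) (rule x)
  qed
  then show "derived G (carrier G) \<subseteq> range (\<lambda>\<alpha>. cprod x \<alpha> n)"
    unfolding derived_def
  proof (rule generate_subgroup_incl [rotated], clarify)
    fix g h assume "g \<in> carrier G" "h \<in> carrier G"
    then show "g \<otimes> h \<otimes> inv g \<otimes> inv h \<in> range (\<lambda>\<alpha>. cprod x \<alpha> n)"
      using comm_eq_cprod unfolding comm_def by blast
  qed
  have "comm G (x i) (x j) \<in> derived G (carrier G)" if "i < n" "j < n" for i j
    unfolding derived_def comm_def using x that by (intro generate.incl) blast
  then show "range (\<lambda>\<alpha>. cprod x \<alpha> n) \<subseteq> derived G (carrier G)"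
    by (auto intro!: cprod_in_subgroup derived_is_subgroup)
qed

text \<open>The space called \<open>R\<close> in the overview: the kernel of \<open>cprod\<close> on
  alternating forms.\<close>

definition relators :: "(nat \<Rightarrow> nat \<Rightarrow> int) set" where
  "relators = {\<alpha>. (\<forall>i<n. \<forall>j<n. int p dvd \<alpha> i j + \<alpha> j i) \<and> cprod x \<alpha> n = \<one>}"

sublocale alternating_forms "int p" n relators
proof
  show "Factorial_Ring.prime (int p)" "odd (int p)" using p odd_p by simp_all
  show "(\<lambda>i j. 0) \<in> relators" using x by (simp add: relators_def cprod_zero)
next
  fix \<xi> \<zeta> c assume "\<xi> \<in> relators" "\<zeta> \<in> relators"
  then show "(\<lambda>i j. \<xi> i j + c * \<zeta> i j) \<in> relators"
    unfolding relators_def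
  proof (intro CollectI conjI allI impI; elim CollectE conjE)
    fix i j assume ij: "i < n" "j < n" "\<forall>i<n. \<forall>j<n. int p dvd \<xi> i j + \<xi> j i" "\<forall>i<n. \<forall>j<n. int p dvd \<zeta> i j + \<zeta> j i"
    then have "int p dvd (\<xi> i j + \<xi> j i) + c * (\<zeta> i j + \<zeta> j i)" by simp
    then show "int p dvd \<xi> i j + c * \<zeta> i j + (\<xi> j i + c * \<zeta> j i)" by (simp add: algebra_simps)
  next
    assume "cprod x \<xi> n = \<one>" "cprod x \<zeta> n = \<one>"
    then show "cprod x (\<lambda>i j. \<xi> i j + c * \<zeta> i j) n = \<one>" using x by (simp add: cprod_add cprod_scale)
  qed
next
  fix \<xi> \<zeta> assume \<xi>: "\<xi> \<in> relators" and cong: "\<And>i j. i < n \<Longrightarrow> j < n \<Longrightarrow> int p dvd \<zeta> i j - \<xi> i j"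
  have "int p dvd \<zeta> i j + \<zeta> j i" if ij: "i < n" "j < n" for i j
  proof -
    have "int p dvd \<xi> i j + \<xi> j i" using \<xi> ij by (simp add: relators_def)
    then have "int p dvd (\<zeta> i j - \<xi> i j) + (\<zeta> j i - \<xi> j i) + (\<xi> i j + \<xi> j i)"
      by (rule dvd_add [OF dvd_add [OF cong [OF ij] cong [OF ij(2,1)]]])
    then show ?thesis by (simp add: algebra_simps)
  qed
  moreover have "cprod x \<zeta> n = cprod x \<xi> n" by (rule cprod_cong_mod) (simp add: cong)
  ultimately show "\<zeta> \<in> relators" using \<xi> by (simp add: relators_def)
next
  fix \<xi> i j assume "\<xi> \<in> relators" "i < n" "j < n"
  then show "int p dvd \<xi> i j + \<xi> j i" unfolding relators_def by blast
qed

text \<open>Modulo the span of \<open>relators\<close> and \<open>\<alpha>\<close>, each form can be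
  moved to the non-leading positions. Relators contribute nothing to the product and
  \<open>\<alpha>\<close> contributes a power of one element, which accounts for the extra factor
  \<open>p\<close>.\<close>

lemma card_derived_le:
  defines "L \<equiv> \<lambda>\<alpha>. lead (int p) pair_weight (lower_pairs n) (case_prod ` ext_by relators \<alpha>)"
  shows "finite (derived G (carrier G))"
    and "card (derived G (carrier G)) \<le> p ^ Suc ((n choose 2) - card (L \<alpha>))"
proof -
  have p0: "0 < int p" using p by (simp add: prime_gt_0_nat)
  let ?P = "lower_pairs n" and ?p = "{0..<int p}"
  have "finite (derived G (carrier G)) \<and> card (derived G (carrier G)) \<le> p ^ Suc ((n choose 2) - card (L \<alpha>))" for \<alpha>
  proof -
    let ?D = "((?P - L \<alpha>) \<rightarrow>\<^sub>E ?p) \<times> ?p"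
    \<comment> \<open>Parametrises the commutator subgroup by residues at non-leading positions and
      one exponent for \<open>cprod x \<alpha> n\<close>.\<close>
    define F where "F = (\<lambda>(\<delta>, c :: int).
      cprod x (\<lambda>i j. if (i, j) \<in> ?P - L \<alpha> then \<delta> (i, j) else 0) n \<otimes> cprod x \<alpha> n [^] c)"
    have LP: "L \<alpha> \<subseteq> ?P" unfolding L_def by (rule lead_subset)
    have finD: "finite ?D" by (intro finite_cartesian_product finite_PiE) simp_all
    have sub: "derived G (carrier G) \<subseteq> F ` ?D"
    proof
      fix d assume "d \<in> derived G (carrier G)"
      then obtain \<beta> where d: "d = cprod x \<beta> n" unfolding derived_eq_cprod by blast
      have "\<exists>y\<in>case_prod ` ext_by relators \<alpha>. \<forall>s\<in>L \<alpha>. int p dvd case_prod \<beta> s - y s"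
        unfolding L_def
      proof (rule reduce_mod_lead [OF _ finite_lower_pairs inj_on_pair_weight])
        show "Factorial_Ring.prime (int p)" using p by simp
        show "case_prod \<alpha> \<in> case_prod ` ext_by relators \<alpha>"
          unfolding ext_by_def
          by (intro imageI CollectI bexI [OF _ R_zero] exI [of _ 1]) simp
      next
        fix y z c assume "y \<in> case_prod ` ext_by relators \<alpha>" "z \<in> case_prod ` ext_by relators \<alpha>"
        then obtain \<eta> \<theta> where y: "y = case_prod \<eta>" "z = case_prod \<theta>" and "\<eta> \<in> ext_by relators \<alpha>" "\<theta> \<in> ext_by relators \<alpha>"
          by blast
        then show "(\<lambda>s. y s + c * z s) \<in> case_prod ` ext_by relators \<alpha>"
          unfolding y by (intro image_eqI [OF _ ext_by_lin [of \<eta> \<alpha> \<theta> c]]) auto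
      qed
      then obtain \<xi> c where \<xi>: "\<xi> \<in> relators"
        and red: "\<And>i j. (i, j) \<in> L \<alpha> \<Longrightarrow> int p dvd \<beta> i j - (\<xi> i j + c * \<alpha> i j)"
        unfolding ext_by_def by fastforce
      define \<gamma> where "\<gamma> i j = \<beta> i j - (\<xi> i j + c * \<alpha> i j)" for i j
      define \<delta> where "\<delta> = restrict (\<lambda>(i, j). \<gamma> i j mod int p) (?P - L \<alpha>)"
      have "d = cprod x (\<lambda>i j. \<gamma> i j + (\<xi> i j + c * \<alpha> i j)) n" by (simp add: d \<gamma>_def)
      also have "\<dots> = cprod x \<gamma> n \<otimes> (cprod x \<xi> n \<otimes> cprod x \<alpha> n [^] c)"
        using x by (simp add: cprod_add cprod_scale)
      also have "cprod x \<xi> n = \<one>" using \<xi> by (simp add: relators_def)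
      also have "cprod x \<alpha> n [^] c = cprod x \<alpha> n [^] (c mod int p)"
        using x exponent by (intro int_pow_cong_exponent [of _ p]) (simp_all add: mod_eq_dvd_iff [symmetric])
      also have "cprod x \<gamma> n = cprod x (\<lambda>i j. if (i, j) \<in> ?P - L \<alpha> then \<delta> (i, j) else 0) n"
      proof (rule cprod_cong_mod)
        fix i j assume "j < i" "i < n"
        then have P: "(i, j) \<in> ?P" by (simp add: lower_pairs_def)
        show "int p dvd \<gamma> i j - (if (i, j) \<in> ?P - L \<alpha> then \<delta> (i, j) else 0)"
        proof (cases "(i, j) \<in> L \<alpha>")
          case True then show ?thesis using red by (simp add: \<gamma>_def)
        next
          case False then show ?thesis using P by (simp add: \<delta>_def mod_eq_dvd_iff [symmetric])
        qed
      qed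
      finally have "d = F (\<delta>, c mod int p)" using x by (simp add: F_def)
      moreover have "(\<delta>, c mod int p) \<in> ?D"
        using p0 by (auto simp: \<delta>_def restrict_PiE_iff)
      ultimately show "d \<in> F ` ?D" by blast
    qed
    have finFD: "finite (F ` ?D)" by (rule finite_imageI [OF finD])
    have "card (derived G (carrier G)) \<le> card (F ` ?D)" by (rule card_mono [OF finFD sub])
    also have "\<dots> \<le> card ?D" by (rule card_image_le [OF finD])
    also have "\<dots> = p ^ Suc ((n choose 2) - card (L \<alpha>))"
      using LP by (simp add: card_cartesian_product card_PiE card_Diff_subset finite_subset [OF LP] card_lower_pairs)
    finally show ?thesis using finite_subset [OF sub finFD] by blast
  qed
  then show "finite (derived G (carrier G))" "card (derived G (carrier G)) \<le> p ^ Suc ((n choose 2) - card (L \<alpha>))"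
    by blast+
qed

definition realize :: "tensor \<Rightarrow> 'a" where
  "realize = (\<lambda>(a, \<alpha>, t). gprod G x a n \<otimes> cprod x \<alpha> n)"

text \<open>The cross term \<open>a i * b j\<close> of tensor multiplication is the correction in
  \<open>gprod_mult\<close>; degree three is ignored.\<close>

lemma realize_mult:
  "realize (u \<otimes>\<^bsub>K\<^esub> v) = realize u \<otimes> realize v"
proof -
  obtain a \<alpha> t b \<beta> s where eq: "u = (a, \<alpha>, t)" "v = (b, \<beta>, s)" by (cases u, cases v)
  let ?a = "gprod G x a n" and ?b = "gprod G x b n" and ?\<alpha> = "cprod x \<alpha> n" and ?\<beta> = "cprod x \<beta> n"
  let ?ab = "gprod G x (\<lambda>i. a i + b i) n" and ?c = "cprod x (\<lambda>i j. a i * b j) n"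
  have cl: "?a \<in> carrier G" "?b \<in> carrier G" "?\<alpha> \<in> carrier G" "?\<beta> \<in> carrier G" "?ab \<in> carrier G" "?c \<in> carrier G"
    using x by auto
  have z: "?\<alpha> \<in> center G" "?c \<in> center G" using x by (auto intro: cprod_center)
  have "realize (u \<otimes>\<^bsub>K\<^esub> v) = ?ab \<otimes> (?\<alpha> \<otimes> ?\<beta> \<otimes> ?c)"
    using x by (simp add: eq tensor_mult realize_def cprod_add)
  also have "?\<alpha> \<otimes> ?\<beta> \<otimes> ?c = ?c \<otimes> (?\<alpha> \<otimes> ?\<beta>)" using z cl by (intro center_commute) auto
  also have "?ab \<otimes> (?c \<otimes> (?\<alpha> \<otimes> ?\<beta>)) = (?ab \<otimes> ?c) \<otimes> (?\<alpha> \<otimes> ?\<beta>)" using cl by (simp add: m_assoc)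
  also have "?ab \<otimes> ?c = ?a \<otimes> ?b" using gprod_mult [of n x a b] x by simp
  also have "?a \<otimes> ?b \<otimes> (?\<alpha> \<otimes> ?\<beta>) = ?a \<otimes> (?b \<otimes> ?\<alpha>) \<otimes> ?\<beta>" using cl by (simp add: m_assoc)
  also have "?b \<otimes> ?\<alpha> = ?\<alpha> \<otimes> ?b" using z cl by (intro center_commute)
  also have "?a \<otimes> (?\<alpha> \<otimes> ?b) \<otimes> ?\<beta> = ?a \<otimes> ?\<alpha> \<otimes> (?b \<otimes> ?\<beta>)" using cl by (simp add: m_assoc)
  finally show ?thesis by (simp add: eq realize_def)
qed

lemma realize_surj: "realize ` carrier K = carrier G"
proof
  show "realize ` carrier K \<subseteq> carrier G" using x by (auto simp: realize_def)
  show "carrier G \<subseteq> realize ` carrier K"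
  proof
    fix g assume "g \<in> carrier G"
    then obtain a d where d: "d \<in> derived G (carrier G)" and g: "g = gprod G x a n \<otimes> d"
      using generating by blast
    obtain \<beta> where \<beta>: "d = cprod x \<beta> n" using d unfolding derived_eq_cprod by blast
    \<comment> \<open>Entries below the diagonal come from \<open>\<beta>\<close>; the carrier
      condition dictates the others modulo \<open>p\<close>, with \<open>(int p + 1) div 2\<close>
      as one half on the diagonal.\<close>
    define \<alpha> where "\<alpha> i j = (if j < i then \<beta> i j else if i < j then a i * a j - \<beta> j i
      else a i * a i * ((int p + 1) div 2))" for i j
    have two: "2 * ((int p + 1) div 2) = int p + 1" using odd_p by (intro dvd_mult_div_cancel) simp
    have "\<alpha> i i + \<alpha> i i - a i * a i = int p * (a i * a i)" for i
    proof -
      have "\<alpha> i i + \<alpha> i i = a i * a i * (2 * ((int p + 1) div 2))" by (simp add: \<alpha>_def)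
      then show ?thesis unfolding two by (simp add: algebra_simps)
    qed
    then have "int p dvd \<alpha> i j + \<alpha> j i - a i * a j" for i j
      by (cases i j rule: linorder_cases) (auto simp: \<alpha>_def)
    then have "(a, \<alpha>, \<lambda>i j l. 0) \<in> carrier K" by (simp add: tensor_carrier)
    moreover have "cprod x \<alpha> n = cprod x \<beta> n" by (rule cprod_cong_mod) (simp add: \<alpha>_def)
    then have "g = realize (a, \<alpha>, \<lambda>i j l. 0)" by (simp add: g \<beta> realize_def)
    ultimately show "g \<in> realize ` carrier K" by blast
  qed
qed

text \<open>Independence forces \<open>p\<close> to divide every \<open>a i\<close>. The carrier
  condition then says that \<open>\<alpha>\<close> is alternating, and the remaining factor makes it
  a relator.\<close>

lemma realize_eq_one_iff:
  assumes "(a, \<alpha>, t) \<in> carrier K"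
  shows "realize (a, \<alpha>, t) = \<one> \<longleftrightarrow> (\<forall>i<n. int p dvd a i) \<and> \<alpha> \<in> relators"
proof
  assume "realize (a, \<alpha>, t) = \<one>"
  then have one: "gprod G x a n \<otimes> cprod x \<alpha> n = \<one>" by (simp add: realize_def)
  then have "gprod G x a n = inv (cprod x \<alpha> n)" using x by (simp add: inv_equality [symmetric])
  then have "gprod G x a n \<in> derived G (carrier G)"
    using subgroup.m_inv_closed [OF derived_is_subgroup [OF order_refl]] derived_eq_cprod by auto
  then have a: "\<forall>i<n. int p dvd a i" using independent by blast
  then have "cprod x \<alpha> n = \<one>" using one gprod_eq_one x by simp
  moreover have "int p dvd \<alpha> i j + \<alpha> j i" if ij: "i < n" "j < n" for i j
  proof -
    have "int p dvd (\<alpha> i j + \<alpha> j i - a i * a j) + a i * a j"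
      using assms a ij unfolding tensor_carrier by (intro dvd_add dvd_mult) blast+
    then show ?thesis by simp
  qed
  ultimately show "(\<forall>i<n. int p dvd a i) \<and> \<alpha> \<in> relators" using a by (simp add: relators_def)
next
  assume "(\<forall>i<n. int p dvd a i) \<and> \<alpha> \<in> relators"
  then show "realize (a, \<alpha>, t) = \<one>" using gprod_eq_one by (simp add: realize_def relators_def)
qed

text \<open>Both sides of \<open>crit\<close> reduce to the same condition on \<open>a\<close> and
  \<open>\<alpha>\<close> once \<open>relators\<close> is closed; the bound on \<open>cap_f\<close>
  serves to prove closedness.\<close>

theorem capable_if_cap_f_less:
  assumes m: "p ^ m \<le> card (derived G (carrier G))" and f: "cap_f ((n choose 2) - m + 1) < n"
  shows "capable G"
proof (rule capable_criterion [OF is_group group_tensor_group])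
  show "realize \<in> hom K G"
    using realize_surj realize_mult by (intro homI) blast+
  show "realize ` carrier K = carrier G" by (rule realize_surj)
  show "rels \<lhd> K" by (rule rels_normal)
  fix y assume y: "y \<in> carrier K"
  obtain a \<alpha> t where eq: "y = (a, \<alpha>, t)" by (cases y)
  have closed: "\<alpha> \<in> relators"
    if anti: "\<And>i j. i < n \<Longrightarrow> j < n \<Longrightarrow> int p dvd \<alpha> i j + \<alpha> j i"
      and ex: "\<And>k. k < n \<Longrightarrow> \<exists>\<xi>. (\<forall>l. \<xi> l \<in> relators) \<and> (\<forall>i<n. \<forall>j<n. \<forall>l<n.
        int p dvd (\<alpha> i j * of_bool (l = k) - of_bool (i = k) * \<alpha> j l) - (\<xi> l i j - \<xi> i j l))"
  proof (rule ccontr)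
    assume "\<alpha> \<notin> relators"
    let ?L = "lead (int p) pair_weight (lower_pairs n) (case_prod ` ext_by relators \<alpha>)"
    have "n \<le> cap_f (card ?L)" by (rule le_cap_f_of_not_closed [OF anti \<open>\<alpha> \<notin> relators\<close> ex])
    moreover have "m \<le> Suc ((n choose 2) - card ?L)"
    proof (rule power_le_imp_le_exp)
      show "1 < p" using prime_gt_1_int [OF p] by simp
      show "p ^ m \<le> p ^ Suc ((n choose 2) - card ?L)" using m card_derived_le(2) by (rule le_trans)
    qed
    \<comment> \<open>Ensures that the truncated difference in the previous bound is a true one, so
      that it can be solved for \<open>card ?L\<close>.\<close>
    moreover have "card ?L \<le> n choose 2"
      using card_mono [OF finite_lower_pairs lead_subset] by (simp add: card_lower_pairs)
    ultimately have "n \<le> cap_f (card ?L)" "card ?L \<le> (n choose 2) - m + 1" by linarith+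
    then show False using f monoD [OF cap_f_mono, of "card ?L" "(n choose 2) - m + 1"] by linarith
  qed
  show "realize y = \<one> \<longleftrightarrow> (\<forall>z\<in>carrier K. \<exists>\<nu>\<in>rels. y \<otimes>\<^bsub>K\<^esub> z = \<nu> \<otimes>\<^bsub>K\<^esub> (z \<otimes>\<^bsub>K\<^esub> y))"
    unfolding eq realize_eq_one_iff [OF y [unfolded eq]]
    by (rule central_mod_rels_iff [OF n y [unfolded eq], symmetric]) (rule closed)
qed

end

section \<open>From the hypotheses on class and rank to a lifted basis\<close>

lemma (in group) class2_group_if_nilpotency_class_le:
  assumes "nilpotency_class_le G 2"
  shows "class2_group G"
proof
  fix g h assume "g \<in> carrier G" "h \<in> carrier G"
  then have gh: "comm G g h \<in> carrier G" "comm G g h \<in> derived G (carrier G)"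
    unfolding derived_def by (simp, intro generate.incl) (auto simp: comm_def)
  have "comm G (comm G g h) y = \<one>" if "y \<in> carrier G" for y
  proof -
    \<comment> \<open>With indexing from zero, threefold commutators lie in term two, which is
      trivial by assumption.\<close>
    have "comm G (comm G g h) y \<in> lower_central G (Suc (Suc 0))"
      unfolding lower_central.simps(2) [of G "Suc 0"] using that gh(2)
      by (intro generate.incl) (auto simp: comm_def [of G "comm G g h"] derived_def)
    then show ?thesis
      using assms by (simp only: nilpotency_class_le_def numeral_2_eq_2 singleton_iff)
  qed
  then show "comm G g h \<in> center G"
    using comm_swap [OF gh(1)] gh(1) by (auto simp: center_def)
qed

lemma (in class2_group) comm_group_commutator_group: "comm_group (commutator_group G)"
proof (rule group.group_comm_groupI)
  have D: "subgroup (derived G (carrier G)) G" by (rule derived_is_subgroup [OF order_refl])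
  then show "group (commutator_group G)"
    unfolding commutator_group_def by (rule subgroup.subgroup_is_group [OF _ is_group])
  fix u v assume "u \<in> carrier (commutator_group G)" "v \<in> carrier (commutator_group G)"
  then show "u \<otimes>\<^bsub>commutator_group G\<^esub> v = v \<otimes>\<^bsub>commutator_group G\<^esub> u"
    using derived_subset_center subgroup.subset [OF D]
    by (auto simp: commutator_group_def intro!: center_commute)
qed

lemma (in class2_group) ex_generated_class2_group:
  assumes p: "Factorial_Ring.prime p" "odd p" and ex: "\<And>g. g \<in> carrier G \<Longrightarrow> g [^] p = \<one>"
    and rank: "has_rank p (abelianization G) n" and n: "n > 1"
  obtains x where "generated_class2_group G p n x"
proof -
  let ?D = "derived G (carrier G)" and ?A = "abelianization G"
  have D: "subgroup ?D G" by (rule derived_is_subgroup [OF order_refl])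
  interpret D: normal ?D G by (rule derived_self_is_normal)
  have A: "comm_group ?A" unfolding abelianization_def by (rule derived_quot_is_comm_group)
  let ?q = "\<lambda>g. ?D #> g"
  have q: "?q \<in> hom G ?A" unfolding abelianization_def by (rule D.r_coset_hom_Mod)
  have cA: "carrier ?A = ?q ` carrier G" unfolding abelianization_def carrier_FactGroup by blast
  interpret A: comm_group ?A by (rule A)
  interpret q: group_hom G ?A ?q by (intro group_hom.intro group_hom_axioms.intro is_group A.is_group q)
  have exA: "c [^]\<^bsub>?A\<^esub> p = \<one>\<^bsub>?A\<^esub>" if "c \<in> carrier ?A" for c
    using that ex q.hom_one unfolding cA by (auto simp: q.hom_nat_pow [symmetric] simp del: q.hom_one)
  obtain b where b: "\<And>i. i < n \<Longrightarrow> b i \<in> carrier ?A"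
    and bgen: "\<And>g. g \<in> carrier ?A \<Longrightarrow> \<exists>c. g = gprod ?A b c n"
    and bind: "\<And>c i. gprod ?A b c n = \<one>\<^bsub>?A\<^esub> \<Longrightarrow> i < n \<Longrightarrow> int p dvd c i"
    using has_rank_basis [OF p(1) A exA rank] by metis
  have "\<forall>i\<in>{..<n}. \<exists>g. g \<in> carrier G \<and> b i = ?q g" using b unfolding cA by blast
  from bchoice [OF this] obtain x where x: "\<forall>i\<in>{..<n}. x i \<in> carrier G \<and> b i = ?q (x i)" ..
  have q_gprod: "?q (gprod G x a n) = gprod ?A b a n" for a
  proof -
    have "?q (gprod G x a n) = gprod ?A (\<lambda>i. ?q (x i)) a n" using x by (intro q.hom_gprod) simp
    also have "\<dots> = gprod ?A b a n" by (rule gprod_cong) (use x in simp)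
    finally show ?thesis .
  qed
  have "generated_class2_group G p n x"
  proof
    show "Factorial_Ring.prime p" "odd p" "n > 1" by fact+
    show "x i \<in> carrier G" if "i < n" for i using x that by simp
    show "g [^] int p = \<one>" if "g \<in> carrier G" for g using ex [OF that] by (simp add: int_pow_int)
  next
    fix g assume g: "g \<in> carrier G"
    then obtain a where a: "?q g = gprod ?A b a n" using bgen cA by blast
    have xa: "gprod G x a n \<in> carrier G" using x by simp
    have "g \<in> ?q (gprod G x a n)" using rcos_self [OF g D] a q_gprod by simp
    then obtain d where d: "d \<in> ?D" "g = d \<otimes> gprod G x a n" by (auto simp: r_coset_def)
    \<comment> \<open>Right cosets put \<open>d\<close> on the left; it is central and may change
      sides.\<close>
    then have "g = gprod G x a n \<otimes> d"
      using center_commute [OF _ xa, of d] derived_subset_center by auto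
    then show "\<exists>a. \<exists>d\<in>?D. g = gprod G x a n \<otimes> d" using d(1) by blast
  next
    fix a i assume a: "gprod G x a n \<in> ?D" and i: "i < n"
    have "?q (gprod G x a n) = ?D" using a D.subset by (intro coset_join2 D) auto
    then have "gprod ?A b a n = \<one>\<^bsub>?A\<^esub>" unfolding q_gprod by (simp add: abelianization_def)
    then show "int p dvd a i" using bind i by blast
  qed
  then show thesis by (rule that)
qed

theorem theorem3p18:
  fixes G :: "('a, 'b) monoid_scheme" and p n m :: nat
  assumes "Factorial_Ring.prime p" and "odd p"
    and "group G"
    and "nilpotency_class_le G 2"
    and "has_exponent G p"
    and "has_rank p (abelianization G) n" and "n > 1"
    and "has_rank p (commutator_group G) m"
    and "cap_f ((n choose 2) - m + 1) < n"
  shows "capable G"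
proof -
  let ?C = "commutator_group G"
  interpret class2_group G by (rule group.class2_group_if_nilpotency_class_le [OF assms(3,4)])
  have ex: "g [^]\<^bsub>G\<^esub> p = \<one>\<^bsub>G\<^esub>" if "g \<in> carrier G" for g
    using assms(5) that by (simp add: has_exponent_def)
  obtain x where "generated_class2_group G p n x"
    using ex_generated_class2_group [OF assms(1,2) ex assms(6,7)] .
  then interpret generated_class2_group G p n x .
  have exC: "u [^]\<^bsub>?C\<^esub> p = \<one>\<^bsub>?C\<^esub>" if "u \<in> carrier ?C" for u
    using that ex derived_in_carrier [OF order_refl]
    by (auto simp: commutator_group_def nat_pow_consistent [symmetric])
  \<comment> \<open>Finiteness comes from the parametrisation in \<open>card_derived_le\<close>, so
    that the rank \<open>m\<close> can be turned into a lower bound for the order.\<close>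
  have fin: "finite (carrier ?C)"
    using card_derived_le(1) by (simp add: commutator_group_def)
  have "p ^ m \<le> card (carrier ?C)"
    by (rule has_rank_card_ge [OF assms(1) comm_group_commutator_group exC assms(8) fin])
  then have "p ^ m \<le> card (derived G (carrier G))" by (simp add: commutator_group_def)
  then show ?thesis using assms(9) by (rule capable_if_cap_f_less)
qed

end
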